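(* Suppose that Assumptions (A), (B) and (C) hold for $(X,\mathcal E,\mathsf d,\delta)$, let $u\in\mathrm{BV}_{\sigma,\mathsf d}([0,T];X)$ be a Visco-Energetic solution to $(X,\mathcal E,\mathsf d,\delta)$, and let $t\in\mathrm J_u$. Let $E\subset\mathbb R$ be compact. A curve $\vartheta\in\mathrm C_{\sigma,\mathsf d}(E;X)$ with $\vartheta(E)\ni u(t)$ is an optimal transition between $u(t-)$ and $u(t+)$ (at time $t$) satisfying $$u(t)\in\vartheta(E)\quad\text{and}\quad\mathcal E(t,u(t-))-\mathcal E(t,u(t+))=\mathrm{Trc}(t,\vartheta,E)$$ if and only if it satisfies $$\mathrm{Var}_{\mathsf d}(\vartheta,E\cap[r_0,r_1])\le\mathcal E(t,\vartheta(r_0))-\mathcal E(t,\vartheta(r_1))\qquad\text{for every }r_0,r_1\in E,\ r_0\le r_1,$$ and $$\vartheta(r)\in\mathrm M(t,\vartheta(r^-_E))\qquad\text{for every }r\in E\setminus\{E^-\},$$ where $r^-_E:=\sup\big((E\cap(-\infty,r))\cup\{E^-\}\big)$.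
   Context: **Setting.** $T>0$; $(X,\sigma)$ is a Hausdorff topological space satisfying the first axiom of countability; $x_o\in X$ is a fixed reference point; $\sigma_{\mathbb R}$ is the product topology on $[0,T]\times X$. $\mathsf d:X\times X\to[0,\infty]$ is a lower semicontinuous asymmetric quasi-distance: $\mathsf d(x,x)=0$, $\mathsf d(x_o,x)<\infty$, $\mathsf d(x,z)\le\mathsf d(x,y)+\mathsf d(y,z)$ for all $x,y,z\in X$. $\mathcal E:[0,T]\times X\to\mathbb R$ is the energy; $\mathcal F(t,x):=\mathcal E(t,x)+\mathsf d(x_o,x)+F_o$, $\mathcal F_0(x):=\mathcal F(0,x)$, where $F_o\ge0$ is a constant such that $\mathcal F\ge0$. Sublevels of $\mathcal F$ are the sets $\{(t,x)\in[0,T]\times X:\mathcal F(t,x)\le C\}$. **Assumption (A).** (A.1) $\mathcal E$ is lower semicontinuous on all the sublevels of $\mathcal F$, which are $\sigma_{\mathbb R}$-sequentially compact in $[0,T]\times X$. (A.2) There is a map $\mathcal P:[0,T]\times X\to\mathbb R$, upper semicontinuous on the sublevels of $\mathcal F$, and a constant $C_P>0$ such that for every $(t,x)$ $$\liminf_{s\uparrow t}\frac{\mathcal E(t,x)-\mathcal E(s,x)}{t-s}\ge\mathcal P(t,x)\ge\limsup_{s\downarrow t}\frac{\mathcal E(s,x)-\mathcal E(t,x)}{s-t},\qquad |\mathcal P(t,x)|\le C_P\mathcal F(t,x).$$ **Viscous correction.** $\delta:X\times X\to[0,\infty]$ is lower semicontinuous with $\delta(x,x)=0$; $\mathsf D(x,y):=\mathsf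 d(x,y)+\delta(x,y)$. For $Q\ge0$, $(t,x)$ is $(\mathsf D,Q)$-quasi-stable if $\mathcal E(t,x)\le\mathcal E(t,y)+\mathsf D(x,y)+Q$ for every $y\in X$. $\mathscr S_{\mathsf D}\subset[0,T]\times X$ is the set of $(\mathsf D,0)$-quasi-stable points, $\mathscr S_{\mathsf D}(t)$ its section at time $t$. **Assumption (B).** (B.1) For all $x,y,z\in X$: $\mathsf d(x,y)=0$ implies $\delta(z,y)\le\delta(z,x)$ and $\delta(x,z)\le\delta(y,z)$. (B.2) If $\sup_n\mathcal F_0(x_n)<\infty$, $x_n\xrightarrow{\sigma}x$ and $\mathsf d(x_n,x)\to0$, then $\delta(x_n,x)\to0$. (B.3) For every $(t,x)\in\mathscr S_{\mathsf D}$ and $M>1$ there exist $\eta>0$ and a neighborhood $U$ of $x$ such that $\mathcal E(s,y)\le\mathcal E(s,x)+M\mathsf d(y,x)$ for every $(s,y)\in\mathscr S_{\mathsf D}$ with $s\in(t-\eta,t]$, $y\in U$, $\mathsf d(y,x)\le\eta$. **Assumption (C).** (C.1) For every $Q\ge0$ the set of $(\mathsf D,Q)$-quasi-stable points has closed intersection with every sublevel of $\mathcal F$. (C.2) $\mathscr S_{\mathsf D}$ is separated by $\mathsf d$: if $u,v\in\mathscr S_{\mathsf D}(t)$ and $\mathsf d(u,v)=0$ then $u=v$. **Minimal set.** $\mathrm M(t,x):=\operatorname{argmin}_{y\in X}\{\mathcal E(t,y)+\mathsf D(x,y)\}$. **Variation and regulated curves.** For $E\subset\mathbb R$ and $u:E\to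 X$, $\mathrm{Var}_{\mathsf d}(u,E):=\sup\sum_{j=1}^M\mathsf d(u(t_{j-1}),u(t_j))$ over finite $t_0<\dots<t_M$ in $E$ (and $0$ if $E=\emptyset$). A curve $u:[a,b]\to X$ is $(\sigma,\mathsf d)$-regulated if for every $t$ the left and right $\sigma$-limits $u(t-),u(t+)$ exist (with $u(a-):=u(a)$, $u(b+):=u(b)$), $\lim_{s\uparrow t}\mathsf d(u(s),u(t-))=0$, $\lim_{s\downarrow t}\mathsf d(u(t+),u(s))=0$, and $\mathsf d(u(t-),u(t))=0\Rightarrow u(t-)=u(t)$, $\mathsf d(u(t),u(t+))=0\Rightarrow u(t)=u(t+)$. Its jump set is $\mathrm J_u:=\{t:u(t-)\ne u(t)\text{ or }u(t)\ne u(t+)\}$. $\mathrm{BV}_{\sigma,\mathsf d}([a,b];X)$ is the set of $(\sigma,\mathsf d)$-regulated curves with $\mathrm{Var}_{\mathsf d}(u,[a,b])<\infty$. **Jump cost.** Residual stability function: $\mathcal R(t,x):=\sup_{y\in X}\{\mathcal E(t,x)-\mathcal E(t,y)-\mathsf D(x,y)\}\ge0$. For $E\subset\mathbb R$ compact, $E^-:=\inf E$, $E^+:=\sup E$, and $\mathfrak H(E)$ is the collection of connected components $I=(I^-,I^+)$ of $[E^-,E^+]\setminus E$. $\mathrm C_{\sigma,\mathsf d}(E;X)$ is the set of $\sigma$-continuous $\vartheta:E\to X$ such that for every $\varepsilon>0$ there is $\eta>0$ with $\mathsf d(\vartheta(s_0),\vartheta(s_1))\le\varepsilon$ whenever $s_0,s_1\in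 E$, $s_0\le s_1\le s_0+\eta$. The transition cost is $$\mathrm{Trc}(t,\vartheta,E):=\mathrm{Var}_{\mathsf d}(\vartheta,E)+\sum_{I\in\mathfrak H(E)}\delta(\vartheta(I^-),\vartheta(I^+))+\sum_{s\in E\setminus\{E^+\}}\mathcal R(t,\vartheta(s))$$ (the last sum is the supremum over finite subsets, and is $0$ if $E\setminus\{E^+\}=\emptyset$), and $\mathsf c(t,u_0,u_1):=\inf\{\mathrm{Trc}(t,\vartheta,E):E\subset\mathbb R\text{ compact},\ \vartheta\in\mathrm C_{\sigma,\mathsf d}(E;X),\ \vartheta(E^-)=u_0,\ \vartheta(E^+)=u_1\}$. Put $\Delta_{\mathsf c}(t,u_0,u_1):=\mathsf c(t,u_0,u_1)-\mathsf d(u_0,u_1)\ge 0$. **Optimal transitions.** $\vartheta\in\mathrm C_{\sigma,\mathsf d}(E;X)$, $E$ compact, is an optimal transition between $u_-$ and $u_+$ at time $t$ if $\vartheta(E^-)=u_-$, $\vartheta(E^+)=u_+$ and $\mathsf c(t,u_-,u_+)=\mathrm{Trc}(t,\vartheta,E)$. **Augmented variation.** For $u\in\mathrm{BV}_{\sigma,\mathsf d}([0,T];X)$ and $[a,b]\subset[0,T]$, $$\mathrm{Var}_{\mathsf d,\mathsf c}(u,[a,b]):=\mathrm{Var}_{\mathsf d}(u,[a,b])+\Delta_{\mathsf c}(a,u(a),u(a+))+\Delta_{\mathsf c}(b,u(b-),u(b))+\sum_{t\in\mathrm J_u\cap(a,b)}\big(\Delta_{\mathsf c}(t,u(t-),u(t))+\Delta_{\mathsf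 c}(t,u(t),u(t+))\big).$$ **Visco-Energetic (VE) solution.** A $(\sigma,\mathsf d)$-regulated curve $u:[0,T]\to X$ such that $u(t)\in\mathscr S_{\mathsf D}(t)$ for every $t\in[0,T]\setminus\mathrm J_u$ and $\mathcal E(t,u(t))+\mathrm{Var}_{\mathsf d,\mathsf c}(u,[0,t])=\mathcal E(0,u(0))+\int_0^t\mathcal P(s,u(s))\,ds$ for every $t\in[0,T]$.
   Formalization: The right-hand side also requires ϑ(E^-)=u(t-) and ϑ(E^+)=u(t+), and it is assumed that F(t,·) is bounded above along every finite-cost transition from u(t-) to u(t+); without these the equivalence fails. *)

theory Defs
  imports "HOL-Analysis.Analysis"
begin

text \<open>
  The space \<open>X\<close> is the whole of a type \<open>'a\<close> of classes \<open>t2_space\<close> and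
  \<open>first_countable_topology\<close>; \<open>[0,T] \<times> X\<close> carries the topology induced by \<open>real \<times> 'a\<close>,
  in which it is closed. The functions \<open>\<E>\<close> and \<open>\<P>\<close> are total, but only their values at times
  in \<open>{0..T}\<close> are used. Quantities with values in \<open>[0,\<infinity>]\<close> are of type \<^typ>\<open>ennreal\<close>; whenever
  they are compared with real energies (which may be negative), both sides are read in
  \<^typ>\<open>ereal\<close>.
\<close>

section \<open>Setting\<close>

definition lsc_on :: "'b::topological_space set \<Rightarrow> ('b \<Rightarrow> 'c::linorder) \<Rightarrow> bool" where
  "lsc_on S f \<longleftrightarrow> (\<forall>x\<in>S. \<forall>c<f x. \<forall>\<^sub>F y in at x within S. c < f y)"

definition usc_on :: "'b::topological_space set \<Rightarrow> ('b \<Rightarrow> 'c::linorder) \<Rightarrow> bool" where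
  "usc_on S f \<longleftrightarrow> (\<forall>x\<in>S. \<forall>c>f x. \<forall>\<^sub>F y in at x within S. f y < c)"

definition asym_quasi_distance :: "'a::topological_space \<Rightarrow> ('a \<Rightarrow> 'a \<Rightarrow> ennreal) \<Rightarrow> bool" where
  "asym_quasi_distance x\<^sub>o d \<longleftrightarrow>
     lsc_on UNIV (\<lambda>(x, y). d x y) \<and>
     (\<forall>x. d x x = 0) \<and>
     (\<forall>x. d x\<^sub>o x < \<infinity>) \<and>
     (\<forall>x y z. d x z \<le> d x y + d y z)"

definition viscous_correction :: "('a::topological_space \<Rightarrow> 'a \<Rightarrow> ennreal) \<Rightarrow> bool" where
  "viscous_correction \<delta> \<longleftrightarrow> lsc_on UNIV (\<lambda>(x, y). \<delta> x y) \<and> (\<forall>x. \<delta> x x = 0)"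

text \<open>The functional \<open>\<F>\<close>; \<open>d x\<^sub>o x\<close> is finite in the setting below.\<close>

definition augmented_energy ::
    "('a \<Rightarrow> 'a \<Rightarrow> ennreal) \<Rightarrow> 'a \<Rightarrow> real \<Rightarrow> (real \<Rightarrow> 'a \<Rightarrow> real) \<Rightarrow> real \<Rightarrow> 'a \<Rightarrow> real" where
  "augmented_energy d x\<^sub>o F\<^sub>o \<E> t x = \<E> t x + enn2real (d x\<^sub>o x) + F\<^sub>o"

definition sublevel :: "real \<Rightarrow> (real \<Rightarrow> 'a \<Rightarrow> real) \<Rightarrow> real \<Rightarrow> (real \<times> 'a) set" where
  "sublevel T \<F> C = {(t, x). t \<in> {0..T} \<and> \<F> t x \<le> C}"

definition ve_setting ::
    "real \<Rightarrow> 'a::{t2_space,first_countable_topology} \<Rightarrow> ('a \<Rightarrow> 'a \<Rightarrow> ennreal) \<Rightarrow>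
     ('a \<Rightarrow> 'a \<Rightarrow> ennreal) \<Rightarrow> (real \<Rightarrow> 'a \<Rightarrow> real) \<Rightarrow> real \<Rightarrow> bool" where
  "ve_setting T x\<^sub>o d \<delta> \<E> F\<^sub>o \<longleftrightarrow>
     0 < T \<and> asym_quasi_distance x\<^sub>o d \<and> viscous_correction \<delta> \<and> 0 \<le> F\<^sub>o \<and>
     (\<forall>t\<in>{0..T}. \<forall>x. 0 \<le> augmented_energy d x\<^sub>o F\<^sub>o \<E> t x)"

section \<open>Assumption (A)\<close>

text \<open>
  At \<open>t = 0\<close> the filter \<open>at t within {0..<t}\<close> is trivial, so that the \<open>Liminf\<close> is \<open>\<infinity>\<close> and the
  left condition is void; likewise for the right condition at \<open>t = T\<close>.
\<close>

definition assumption_A ::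
    "real \<Rightarrow> 'a::{t2_space,first_countable_topology} \<Rightarrow> ('a \<Rightarrow> 'a \<Rightarrow> ennreal) \<Rightarrow>
     (real \<Rightarrow> 'a \<Rightarrow> real) \<Rightarrow> real \<Rightarrow> (real \<Rightarrow> 'a \<Rightarrow> real) \<Rightarrow> bool" where
  "assumption_A T x\<^sub>o d \<E> F\<^sub>o \<P> \<longleftrightarrow>
     (let \<F> = augmented_energy d x\<^sub>o F\<^sub>o \<E> in
       (\<forall>C. lsc_on (sublevel T \<F> C) (\<lambda>(t, x). \<E> t x) \<and> seq_compact (sublevel T \<F> C)) \<and>
       (\<forall>C. usc_on (sublevel T \<F> C) (\<lambda>(t, x). \<P> t x)) \<and>
       (\<exists>C\<^sub>P>0. \<forall>t\<in>{0..T}. \<forall>x.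
          Liminf (at t within {0..<t}) (\<lambda>s. ereal ((\<E> t x - \<E> s x) / (t - s))) \<ge> ereal (\<P> t x) \<and>
          ereal (\<P> t x) \<ge> Limsup (at t within {t<..T}) (\<lambda>s. ereal ((\<E> s x - \<E> t x) / (s - t))) \<and>
          \<bar>\<P> t x\<bar> \<le> C\<^sub>P * \<F> t x))"

section \<open>Viscous stability and assumptions (B), (C)\<close>

definition D_of :: "('a \<Rightarrow> 'a \<Rightarrow> ennreal) \<Rightarrow> ('a \<Rightarrow> 'a \<Rightarrow> ennreal) \<Rightarrow> 'a \<Rightarrow> 'a \<Rightarrow> ennreal" where
  "D_of d \<delta> x y = d x y + \<delta> x y"

definition quasi_stable ::
    "('a \<Rightarrow> 'a \<Rightarrow> ennreal) \<Rightarrow> (real \<Rightarrow> 'a \<Rightarrow> real) \<Rightarrow> real \<Rightarrow> real \<Rightarrow> 'a \<Rightarrow> bool" where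
  "quasi_stable D \<E> Q t x \<longleftrightarrow>
     (\<forall>y. ereal (\<E> t x) \<le> ereal (\<E> t y) + enn2ereal (D x y) + ereal Q)"

definition quasi_stable_set ::
    "real \<Rightarrow> ('a \<Rightarrow> 'a \<Rightarrow> ennreal) \<Rightarrow> (real \<Rightarrow> 'a \<Rightarrow> real) \<Rightarrow> real \<Rightarrow> (real \<times> 'a) set" where
  "quasi_stable_set T D \<E> Q = {(t, x). t \<in> {0..T} \<and> quasi_stable D \<E> Q t x}"

definition stable_set ::
    "real \<Rightarrow> ('a \<Rightarrow> 'a \<Rightarrow> ennreal) \<Rightarrow> (real \<Rightarrow> 'a \<Rightarrow> real) \<Rightarrow> (real \<times> 'a) set" where
  "stable_set T D \<E> = quasi_stable_set T D \<E> 0"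

definition assumption_B ::
    "real \<Rightarrow> 'a::{t2_space,first_countable_topology} \<Rightarrow> ('a \<Rightarrow> 'a \<Rightarrow> ennreal) \<Rightarrow>
     ('a \<Rightarrow> 'a \<Rightarrow> ennreal) \<Rightarrow> (real \<Rightarrow> 'a \<Rightarrow> real) \<Rightarrow> real \<Rightarrow> bool" where
  "assumption_B T x\<^sub>o d \<delta> \<E> F\<^sub>o \<longleftrightarrow>
     (let \<F> = augmented_energy d x\<^sub>o F\<^sub>o \<E>; S = stable_set T (D_of d \<delta>) \<E> in
       (\<forall>x y z. d x y = 0 \<longrightarrow> \<delta> z y \<le> \<delta> z x \<and> \<delta> x z \<le> \<delta> y z) \<and>
       (\<forall>xs x. bdd_above (range (\<lambda>n. \<F> 0 (xs n))) \<and> xs \<longlonglongrightarrow> x \<and> (\<lambda>n. d (xs n) x) \<longlonglongrightarrow> 0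
          \<longrightarrow> (\<lambda>n. \<delta> (xs n) x) \<longlonglongrightarrow> 0) \<and>
       (\<forall>(t, x)\<in>S. \<forall>M>1. \<exists>\<eta>>0. \<exists>U. open U \<and> x \<in> U \<and>
          (\<forall>(s, y)\<in>S. s \<in> {t - \<eta><..t} \<and> y \<in> U \<and> d y x \<le> ennreal \<eta> \<longrightarrow>
             ereal (\<E> s y) \<le> ereal (\<E> s x) + ereal M * enn2ereal (d y x))))"

definition assumption_C ::
    "real \<Rightarrow> 'a::{t2_space,first_countable_topology} \<Rightarrow> ('a \<Rightarrow> 'a \<Rightarrow> ennreal) \<Rightarrow>
     ('a \<Rightarrow> 'a \<Rightarrow> ennreal) \<Rightarrow> (real \<Rightarrow> 'a \<Rightarrow> real) \<Rightarrow> real \<Rightarrow> bool" where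
  "assumption_C T x\<^sub>o d \<delta> \<E> F\<^sub>o \<longleftrightarrow>
     (\<forall>Q\<ge>0. \<forall>C. closed (quasi_stable_set T (D_of d \<delta>) \<E> Q \<inter>
                          sublevel T (augmented_energy d x\<^sub>o F\<^sub>o \<E>) C)) \<and>
     (\<forall>t u v. (t, u) \<in> stable_set T (D_of d \<delta>) \<E> \<and> (t, v) \<in> stable_set T (D_of d \<delta>) \<E> \<and>
        d u v = 0 \<longrightarrow> u = v)"

text \<open>The minimal set \<open>M(t,x)\<close>.\<close>

definition minimal_set ::
    "('a \<Rightarrow> 'a \<Rightarrow> ennreal) \<Rightarrow> (real \<Rightarrow> 'a \<Rightarrow> real) \<Rightarrow> real \<Rightarrow> 'a \<Rightarrow> 'a set" where
  "minimal_set D \<E> t x =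
     {y. is_arg_min (\<lambda>z. ereal (\<E> t z) + enn2ereal (D x z)) (\<lambda>_. True) y}"

section \<open>Variation and regulated curves\<close>

text \<open>The supremum over the empty set (for \<open>E = {}\<close>) is \<open>0\<close> in \<^typ>\<open>ennreal\<close>.\<close>

definition Var :: "('a \<Rightarrow> 'a \<Rightarrow> ennreal) \<Rightarrow> (real \<Rightarrow> 'a) \<Rightarrow> real set \<Rightarrow> ennreal" where
  "Var d u E =
     Sup {\<Sum>j<M. d (u (\<tau> j)) (u (\<tau> (Suc j))) | M \<tau>.
            (\<forall>j\<le>M. \<tau> j \<in> E) \<and> (\<forall>j<M. \<tau> j < \<tau> (Suc j))}"

text \<open>
  One-sided limits of a curve on \<open>[a,b]\<close>, with the conventions \<open>u(a-) = u(a)\<close> and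
  \<open>u(b+) = u(b)\<close>. The first parameter is the left (resp. right) endpoint of the interval.
\<close>

definition left_val :: "real \<Rightarrow> (real \<Rightarrow> 'a::t2_space) \<Rightarrow> real \<Rightarrow> 'a" where
  "left_val a u t = (if t = a then u a else Lim (at_left t) u)"

definition right_val :: "real \<Rightarrow> (real \<Rightarrow> 'a::t2_space) \<Rightarrow> real \<Rightarrow> 'a" where
  "right_val b u t = (if t = b then u b else Lim (at_right t) u)"

definition regulated ::
    "('a::t2_space \<Rightarrow> 'a \<Rightarrow> ennreal) \<Rightarrow> real \<Rightarrow> real \<Rightarrow> (real \<Rightarrow> 'a) \<Rightarrow> bool" where
  "regulated d a b u \<longleftrightarrow>
     (\<forall>t\<in>{a<..b}. (\<exists>l. (u \<longlongrightarrow> l) (at_left t)) \<and>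
        ((\<lambda>s. d (u s) (left_val a u t)) \<longlongrightarrow> 0) (at_left t)) \<and>
     (\<forall>t\<in>{a..<b}. (\<exists>l. (u \<longlongrightarrow> l) (at_right t)) \<and>
        ((\<lambda>s. d (right_val b u t) (u s)) \<longlongrightarrow> 0) (at_right t)) \<and>
     (\<forall>t\<in>{a..b}. (d (left_val a u t) (u t) = 0 \<longrightarrow> left_val a u t = u t) \<and>
        (d (u t) (right_val b u t) = 0 \<longrightarrow> u t = right_val b u t))"

definition jump_set :: "real \<Rightarrow> real \<Rightarrow> (real \<Rightarrow> 'a::t2_space) \<Rightarrow> real set" where
  "jump_set a b u = {t\<in>{a..b}. left_val a u t \<noteq> u t \<or> u t \<noteq> right_val b u t}"

definition BV :: "('a::t2_space \<Rightarrow> 'a \<Rightarrow> ennreal) \<Rightarrow> real \<Rightarrow> real \<Rightarrow> (real \<Rightarrow> 'a) set" where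
  "BV d a b = {u. regulated d a b u \<and> Var d u {a..b} < \<infinity>}"

section \<open>Transition cost\<close>

text \<open>The supremum is nonnegative (take \<open>y = x\<close>), so \<^const>\<open>e2ennreal\<close> loses nothing.\<close>

definition residual ::
    "('a \<Rightarrow> 'a \<Rightarrow> ennreal) \<Rightarrow> (real \<Rightarrow> 'a \<Rightarrow> real) \<Rightarrow> real \<Rightarrow> 'a \<Rightarrow> ennreal" where
  "residual D \<E> t x = e2ennreal (SUP y. ereal (\<E> t x) - ereal (\<E> t y) - enn2ereal (D x y))"

definition C_curves ::
    "('a::t2_space \<Rightarrow> 'a \<Rightarrow> ennreal) \<Rightarrow> real set \<Rightarrow> (real \<Rightarrow> 'a) set" where
  "C_curves d E = {\<theta>. continuous_on E \<theta> \<and>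
     (\<forall>\<epsilon>>0. \<exists>\<eta>>0. \<forall>s\<^sub>0\<in>E. \<forall>s\<^sub>1\<in>E. s\<^sub>0 \<le> s\<^sub>1 \<and> s\<^sub>1 \<le> s\<^sub>0 + \<eta> \<longrightarrow> d (\<theta> s\<^sub>0) (\<theta> s\<^sub>1) \<le> ennreal \<epsilon>)}"

definition holes :: "real set \<Rightarrow> real set set" where
  "holes E = components ({Inf E..Sup E} - E)"

text \<open>In \<^typ>\<open>ennreal\<close>, \<^const>\<open>infsum\<close> is the supremum of the finite partial sums.\<close>

definition Trc ::
    "('a \<Rightarrow> 'a \<Rightarrow> ennreal) \<Rightarrow> ('a \<Rightarrow> 'a \<Rightarrow> ennreal) \<Rightarrow> (real \<Rightarrow> 'a \<Rightarrow> real) \<Rightarrow>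
     real \<Rightarrow> (real \<Rightarrow> 'a) \<Rightarrow> real set \<Rightarrow> ennreal" where
  "Trc d \<delta> \<E> t \<theta> E =
     Var d \<theta> E + (\<Sum>\<^sub>\<infinity>I\<in>holes E. \<delta> (\<theta> (Inf I)) (\<theta> (Sup I)))
       + (\<Sum>\<^sub>\<infinity>s\<in>E - {Sup E}. residual (D_of d \<delta>) \<E> t (\<theta> s))"

definition transitions ::
    "('a::t2_space \<Rightarrow> 'a \<Rightarrow> ennreal) \<Rightarrow> 'a \<Rightarrow> 'a \<Rightarrow> ((real \<Rightarrow> 'a) \<times> real set) set" where
  "transitions d u\<^sub>0 u\<^sub>1 = {(\<theta>, E). compact E \<and> E \<noteq> {} \<and> \<theta> \<in> C_curves d E \<and>
     \<theta> (Inf E) = u\<^sub>0 \<and> \<theta> (Sup E) = u\<^sub>1}"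

definition cost ::
    "('a::t2_space \<Rightarrow> 'a \<Rightarrow> ennreal) \<Rightarrow> ('a \<Rightarrow> 'a \<Rightarrow> ennreal) \<Rightarrow> (real \<Rightarrow> 'a \<Rightarrow> real) \<Rightarrow>
     real \<Rightarrow> 'a \<Rightarrow> 'a \<Rightarrow> ennreal" where
  "cost d \<delta> \<E> t u\<^sub>0 u\<^sub>1 = (INF (\<theta>, E)\<in>transitions d u\<^sub>0 u\<^sub>1. Trc d \<delta> \<E> t \<theta> E)"

definition Delta_cost ::
    "('a::t2_space \<Rightarrow> 'a \<Rightarrow> ennreal) \<Rightarrow> ('a \<Rightarrow> 'a \<Rightarrow> ennreal) \<Rightarrow> (real \<Rightarrow> 'a \<Rightarrow> real) \<Rightarrow>
     real \<Rightarrow> 'a \<Rightarrow> 'a \<Rightarrow> ennreal" where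
  "Delta_cost d \<delta> \<E> t u\<^sub>0 u\<^sub>1 = cost d \<delta> \<E> t u\<^sub>0 u\<^sub>1 - d u\<^sub>0 u\<^sub>1"

definition optimal_transition ::
    "('a::t2_space \<Rightarrow> 'a \<Rightarrow> ennreal) \<Rightarrow> ('a \<Rightarrow> 'a \<Rightarrow> ennreal) \<Rightarrow> (real \<Rightarrow> 'a \<Rightarrow> real) \<Rightarrow>
     real \<Rightarrow> 'a \<Rightarrow> 'a \<Rightarrow> (real \<Rightarrow> 'a) \<Rightarrow> real set \<Rightarrow> bool" where
  "optimal_transition d \<delta> \<E> t u\<^sub>0 u\<^sub>1 \<theta> E \<longleftrightarrow>
     (\<theta>, E) \<in> transitions d u\<^sub>0 u\<^sub>1 \<and> cost d \<delta> \<E> t u\<^sub>0 u\<^sub>1 = Trc d \<delta> \<E> t \<theta> E"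

text \<open>
  Transitions of finite cost from \<open>u\<^sub>0\<close> to \<open>u\<^sub>1\<close> do not leave the sublevels of \<open>\<F>\<close>. This is needed
  for the energy estimate \<open>\<E>(t,u\<^sub>0) - \<E>(t,u\<^sub>1) \<le> c(t,u\<^sub>0,u\<^sub>1)\<close>, since (A.1), (B.2) and (C.1) give
  information on sublevels only, and it does not follow from (A), (B), (C): let \<open>X\<close> be the subset
  \<open>x = (0,0)\<close>, \<open>b = (2,0)\<close>, \<open>x\<^sub>n = (2^-n, 0)\<close> for \<open>n \<ge> 0\<close>, \<open>y\<^sub>n = (2^-n, 2^-(n+1))\<close> for
  \<open>n \<ge> 1\<close> of the plane, \<open>d\<close> the Euclidean distance, \<open>\<P> = 0\<close>, and \<open>\<E>\<close> constant in time with
  \<open>\<E>(x) = -10\<close>, \<open>\<E>(b) = -1\<close>, \<open>\<E>(x\<^sub>n) = n\<close>, \<open>\<E>(y\<^sub>n) = n - 2^-n\<close>. Let \<open>\<delta> = 0\<close>, except that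
  \<open>\<delta>(x\<^sub>0,\<cdot>) = \<infinity>\<close> off \<open>{x\<^sub>0,x\<^sub>1,b}\<close>, \<open>\<delta>(b,\<cdot>) = \<infinity>\<close> off \<open>{b,x}\<close> and, for \<open>n \<ge> 1\<close>,
  \<open>\<delta>(x\<^sub>n,\<cdot>) = \<infinity>\<close> off \<open>{x\<^sub>n,x\<^sub>n\<^sub>+\<^sub>1,y\<^sub>n}\<close>. The stable points are \<open>x\<^sub>0\<close> and \<open>x\<close>, the residual
  stability of \<open>x\<^sub>n\<close> (\<open>n \<ge> 1\<close>) is \<open>2^-(n+1)\<close>, and the transition \<open>x\<^sub>0, x\<^sub>1, x\<^sub>2, \<dots>, x\<close> costs
  \<open>3/2\<close> while the energy drops by \<open>10\<close>.
\<close>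

definition bounded_transitions ::
    "('a::t2_space \<Rightarrow> 'a \<Rightarrow> ennreal) \<Rightarrow> ('a \<Rightarrow> 'a \<Rightarrow> ennreal) \<Rightarrow> (real \<Rightarrow> 'a \<Rightarrow> real) \<Rightarrow>
     (real \<Rightarrow> 'a \<Rightarrow> real) \<Rightarrow> real \<Rightarrow> 'a \<Rightarrow> 'a \<Rightarrow> bool" where
  "bounded_transitions d \<delta> \<E> \<F> t u\<^sub>0 u\<^sub>1 \<longleftrightarrow>
     (\<forall>(\<theta>, E)\<in>transitions d u\<^sub>0 u\<^sub>1. Trc d \<delta> \<E> t \<theta> E < \<infinity> \<longrightarrow>
        bdd_above ((\<lambda>s. \<F> t (\<theta> s)) ` E))"

section \<open>Visco-Energetic solutions\<close>

text \<open>
  The limits at the endpoints are those of the curve restricted to \<open>[a,b]\<close>. For \<open>a < b\<close> they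
  coincide with the one-sided limits of a curve defined on a larger interval; for \<open>a = b\<close> the
  augmented variation vanishes.
\<close>

definition Var_dc ::
    "('a::t2_space \<Rightarrow> 'a \<Rightarrow> ennreal) \<Rightarrow> ('a \<Rightarrow> 'a \<Rightarrow> ennreal) \<Rightarrow> (real \<Rightarrow> 'a \<Rightarrow> real) \<Rightarrow>
     (real \<Rightarrow> 'a) \<Rightarrow> real \<Rightarrow> real \<Rightarrow> ennreal" where
  "Var_dc d \<delta> \<E> u a b =
     Var d u {a..b}
     + Delta_cost d \<delta> \<E> a (u a) (right_val b u a)
     + Delta_cost d \<delta> \<E> b (left_val a u b) (u b)
     + (\<Sum>\<^sub>\<infinity>t\<in>jump_set a b u \<inter> {a<..<b}.
          Delta_cost d \<delta> \<E> t (left_val a u t) (u t) + Delta_cost d \<delta> \<E> t (u t) (right_val b u t))"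

text \<open>
  Lebesgue integrability of \<open>s \<mapsto> \<P>(s,u(s))\<close> makes the integral in the balance meaningful
  (Isabelle's integral of a non-integrable function is \<open>0\<close>).
\<close>

definition VE_solution ::
    "real \<Rightarrow> ('a::t2_space \<Rightarrow> 'a \<Rightarrow> ennreal) \<Rightarrow> ('a \<Rightarrow> 'a \<Rightarrow> ennreal) \<Rightarrow> (real \<Rightarrow> 'a \<Rightarrow> real) \<Rightarrow>
     (real \<Rightarrow> 'a \<Rightarrow> real) \<Rightarrow> (real \<Rightarrow> 'a) \<Rightarrow> bool" where
  "VE_solution T d \<delta> \<E> \<P> u \<longleftrightarrow>
     regulated d 0 T u \<and>
     (\<forall>t\<in>{0..T} - jump_set 0 T u. (t, u t) \<in> stable_set T (D_of d \<delta>) \<E>) \<and>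
     set_integrable lebesgue {0..T} (\<lambda>s. \<P> s (u s)) \<and>
     (\<forall>t\<in>{0..T}. ereal (\<E> t (u t)) + enn2ereal (Var_dc d \<delta> \<E> u 0 t)
        = ereal (\<E> 0 (u 0) + (LINT s:{0..t}|lebesgue. \<P> s (u s))))"

text \<open>The point \<open>r\<^sup>-\<close> of \<open>E\<close> preceding \<open>r\<close> (equal to \<open>r\<close> if \<open>r\<close> is a left accumulation point).\<close>

definition pred_pt :: "real set \<Rightarrow> real \<Rightarrow> real" where
  "pred_pt E r = Sup ((E \<inter> {..<r}) \<union> {Inf E})"

end

theory Submission
  imports Defs
begin

text \<open>
  Write \<open>e(r) = \<E>(t,\<theta>(r))\<close> and let \<open>\<tau>(r)\<close> be the part of the transition cost spent up to \<open>r\<close>. Along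
  every transition of finite cost inside a sublevel of \<open>\<F>\<close>, \<open>e + \<tau>\<close> is nondecreasing. Across a hole this is the definition of
  the residual stability. At an accumulation point of \<open>E\<close> the residual vanishes, by summability and
  (C.1), so the point is stable, and (B.3) compares it with the stable points on its left up to a
  factor \<open>M > 1\<close>; the isolated points accumulating from the left are handled by the upper
  semicontinuity of \<open>e\<close> from the left, which follows from (B.2) since (A.2) bounds \<open>\<F>\<^sub>0\<close> on the
  sublevels of \<open>\<F>\<close>. Letting \<open>M\<close> tend to \<open>1\<close> gives the lower bound for the cost. If the energy drop
  equals the total cost, then \<open>e + \<tau>\<close> is constant, which is the variation inequality on each piece
  and the minimality across each hole. Conversely the two conditions, added up over finitely many
  holes and the pieces between them, bound the cost by the energy drop, the residual being zero off
  the left endpoints of holes.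
\<close>

section \<open>Variation\<close>

lemma Var_upper:
  assumes "\<And>j. j \<le> M \<Longrightarrow> \<tau> j \<in> S" "\<And>j. j < M \<Longrightarrow> \<tau> j < \<tau> (Suc j)"
  shows "(\<Sum>j<M. d (u (\<tau> j)) (u (\<tau> (Suc j)))) \<le> Var d u S"
  unfolding Var_def using assms by (intro Sup_upper) blast

lemma Var_least:
  assumes "\<And>M \<tau>. (\<And>j. j \<le> M \<Longrightarrow> \<tau> j \<in> S) \<Longrightarrow> (\<And>j. j < M \<Longrightarrow> \<tau> j < \<tau> (Suc j)) \<Longrightarrow>
      (\<Sum>j<M. d (u (\<tau> j)) (u (\<tau> (Suc j)))) \<le> c"
  shows "Var d u S \<le> c"
  unfolding Var_def using assms by (intro Sup_least) auto

lemma Var_mono: "S \<subseteq> S' \<Longrightarrow> Var d u S \<le> Var d u S'"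
  by (intro Var_least Var_upper) auto

lemma Var_ge_dist:
  assumes "a \<in> S" "b \<in> S" "a \<le> b" "d (u a) (u a) = 0"
  shows "d (u a) (u b) \<le> Var d u S"
proof (cases "a = b")
  case False
  then show ?thesis
    using Var_upper[of 1 "\<lambda>j. if j = 0 then a else b" S d u] assms by auto
qed (use assms in auto)

text \<open>The partial sums telescope against \<open>G\<close>, so bounding a variation reduces to
  exhibiting a function that grows by at least \<open>d\<close> between any two points.\<close>

lemma Var_le_potential:
  fixes G :: "real \<Rightarrow> ennreal"
  assumes step: "\<And>x y. x \<in> S \<Longrightarrow> y \<in> S \<Longrightarrow> x < y \<Longrightarrow> d (u x) (u y) + G x \<le> G y"
    and bound: "\<And>y. y \<in> S \<Longrightarrow> G y \<le> c"
  shows "Var d u S \<le> c"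
proof (rule Var_least)
  fix M \<tau> assume \<tau>: "\<And>j. j \<le> M \<Longrightarrow> \<tau> j \<in> S" "\<And>j. j < M \<Longrightarrow> \<tau> j < \<tau> (Suc j)"
  have "(\<Sum>j<m. d (u (\<tau> j)) (u (\<tau> (Suc j)))) \<le> G (\<tau> m)" if "m \<le> M" for m
    using that
  proof (induction m)
    case (Suc m)
    have "(\<Sum>j<Suc m. d (u (\<tau> j)) (u (\<tau> (Suc j)))) \<le> G (\<tau> m) + d (u (\<tau> m)) (u (\<tau> (Suc m)))"
      using Suc by (simp add: add_right_mono)
    also have "\<dots> \<le> G (\<tau> (Suc m))"
      using step[of "\<tau> m" "\<tau> (Suc m)"] \<tau> Suc.prems by (simp add: add.commute)
    finally show ?case .
  qed auto
  from this[of M] bound[of "\<tau> M"] \<tau>(1)[of M]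
  show "(\<Sum>j<M. d (u (\<tau> j)) (u (\<tau> (Suc j)))) \<le> c" by (meson order.trans order_refl)
qed

lemma Var_singleton: "Var d u {a} = 0"
  using Var_le_potential[of "{a}" d u "\<lambda>_. 0" 0] by auto

section \<open>Splitting the variation at a point of the time set\<close>

lemma sum_lessThan_split:
  fixes f :: "nat \<Rightarrow> 'b::comm_monoid_add"
  shows "(\<Sum>j<m + n. f j) = (\<Sum>j<m. f j) + (\<Sum>j<n. f (m + j))"
  by (induction n) (auto simp: add.assoc)

lemma Sup_add_le_ennreal:
  fixes A B :: "ennreal set"
  assumes "A \<noteq> {}" "B \<noteq> {}" "\<And>a b. a \<in> A \<Longrightarrow> b \<in> B \<Longrightarrow> a + b \<le> c"
  shows "Sup A + Sup B \<le> c"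
proof -
  have "a + Sup B \<le> c" if "a \<in> A" for a
    using ennreal_SUP_add_right[OF assms(2), of a "\<lambda>x. x"] assms(3)[OF that]
    by (auto intro: SUP_least)
  then show ?thesis
    using ennreal_SUP_add_left[OF assms(1), of "\<lambda>x. x" "Sup B"] SUP_least[of A "\<lambda>x. x + Sup B" c] by simp
qed

text \<open>Partitions of the two pieces concatenate to a partition of the whole. Membership of
  \<open>y\<close> provides one-point partitions, so neither supremum is over the empty set.\<close>

lemma Var_superadditive:
  assumes "y \<in> S" "x \<le> y" "y \<le> z"
  shows "Var d u (S \<inter> {x..y}) + Var d u (S \<inter> {y..z}) \<le> Var d u (S \<inter> {x..z})"
  unfolding Var_def[of d u "S \<inter> {x..y}"] Var_def[of d u "S \<inter> {y..z}"]
proof (rule Sup_add_le_ennreal, goal_cases)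
  case 1
  then show ?case using assms by (auto intro!: exI[of _ "0::nat"] exI[of _ "\<lambda>_. y"])
next
  case 2
  then show ?case using assms by (auto intro!: exI[of _ "0::nat"] exI[of _ "\<lambda>_. y"])
next
  case (3 a b)
  then obtain M \<sigma> N \<tau> where
    a: "a = (\<Sum>j<M. d (u (\<sigma> j)) (u (\<sigma> (Suc j))))" and
    \<sigma>: "\<And>j. j \<le> M \<Longrightarrow> \<sigma> j \<in> S \<inter> {x..y}" "\<And>j. j < M \<Longrightarrow> \<sigma> j < \<sigma> (Suc j)" and
    b: "b = (\<Sum>j<N. d (u (\<tau> j)) (u (\<tau> (Suc j))))" and
    \<tau>: "\<And>j. j \<le> N \<Longrightarrow> \<tau> j \<in> S \<inter> {y..z}" "\<And>j. j < N \<Longrightarrow> \<tau> j < \<tau> (Suc j)"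
    by blast
  have le: "\<sigma> M \<le> \<tau> 0" using \<sigma>(1)[of M] \<tau>(1)[of 0] by auto
  show ?case
  \<comment> \<open>Partitions are strictly increasing, so a node common to both is kept only
    once.\<close>
  proof (cases "\<sigma> M = \<tau> 0")
    case eq: True
    define \<rho> where "\<rho> j = (if j \<le> M then \<sigma> j else \<tau> (j - M))" for j
    have \<rho>\<tau>: "\<rho> (M + j) = \<tau> j" "\<rho> (Suc (M + j)) = \<tau> (Suc j)" for j
      using eq by (auto simp: \<rho>_def)
    have "(\<Sum>j<M + N. d (u (\<rho> j)) (u (\<rho> (Suc j)))) \<le> Var d u (S \<inter> {x..z})"
    proof (rule Var_upper)
      fix j assume "j \<le> M + N"
      then have "j - M \<le> N" by simp
      then show "\<rho> j \<in> S \<inter> {x..z}"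
        using \<sigma>(1)[of j] \<tau>(1)[of "j - M"] assms(2,3) by (cases "j \<le> M") (auto simp: \<rho>_def)
    next
      fix j assume j: "j < M + N"
      show "\<rho> j < \<rho> (Suc j)"
      proof (cases "j < M")
        case False
        then obtain k where "j = M + k" "k < N" using j by (metis add_diff_inverse_nat nat_add_left_cancel_less)
        then show ?thesis using \<tau>(2)[of k] \<rho>\<tau> by auto
      qed (use \<sigma>(2)[of j] in \<open>auto simp: \<rho>_def\<close>)
    qed
    then show ?thesis
      by (simp add: sum_lessThan_split \<rho>\<tau>) (simp add: a b \<rho>_def)
  next
    case False
    define \<rho> where "\<rho> j = (if j \<le> M then \<sigma> j else \<tau> (j - Suc M))" for j
    have \<rho>\<tau>: "\<rho> (Suc M + j) = \<tau> j" "\<rho> (Suc (Suc M + j)) = \<tau> (Suc j)" for j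
      by (auto simp: \<rho>_def)
    have "(\<Sum>j<Suc M + N. d (u (\<rho> j)) (u (\<rho> (Suc j)))) \<le> Var d u (S \<inter> {x..z})"
    proof (rule Var_upper)
      fix j assume "j \<le> Suc M + N"
      then have "j - Suc M \<le> N" by simp
      then show "\<rho> j \<in> S \<inter> {x..z}"
        using \<sigma>(1)[of j] \<tau>(1)[of "j - Suc M"] assms(2,3) by (cases "j \<le> M") (auto simp: \<rho>_def)
    next
      fix j assume j: "j < Suc M + N"
      consider "j < M" | "j = M" | k where "j = Suc M + k" "k < N"
        using j by (metis add_diff_inverse_nat nat_add_left_cancel_less not_less_less_Suc_eq)
      then show "\<rho> j < \<rho> (Suc j)"
      proof cases
        case 2
        then show ?thesis using le False by (simp add: \<rho>_def)
      next
        case 3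
        then show ?thesis using \<tau>(2)[of k] \<rho>\<tau> by metis
      qed (use \<sigma>(2)[of j] in \<open>auto simp: \<rho>_def\<close>)
    qed
    moreover have "a + b \<le> (\<Sum>j<Suc M + N. d (u (\<rho> j)) (u (\<rho> (Suc j))))"
      unfolding sum_lessThan_split \<rho>\<tau> by (simp add: a b \<rho>_def add_mono)
    ultimately show ?thesis by order
  qed
qed

text \<open>A step straddling \<open>y\<close> is replaced by two steps through \<open>y\<close>,
  which by the triangle inequality does not decrease the sum.\<close>

lemma Var_subadditive:
  assumes refl: "\<And>x. d x x = 0" and tri: "\<And>x y z. d x z \<le> d x y + d y z"
    and "y \<in> S" "x \<le> y" "y \<le> z"
  shows "Var d u (S \<inter> {x..z}) \<le> Var d u (S \<inter> {x..y}) + Var d u (S \<inter> {y..z})"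
proof (rule Var_le_potential)
  \<comment> \<open>\<open>G w\<close> is the variation accumulated up to \<open>w\<close> when a
    stop at \<open>y\<close> is forced.\<close>
  define G where "G w = (if w \<le> y then Var d u (S \<inter> {x..w})
    else Var d u (S \<inter> {x..y}) + Var d u (S \<inter> {y..w}))" for w
  have step: "d (u v) (u w) + Var d u (S \<inter> {c..v}) \<le> Var d u (S \<inter> {c..w})"
    if "v \<in> S" "w \<in> S" "c \<le> v" "v \<le> w" for v w c
  proof -
    have "d (u v) (u w) \<le> Var d u (S \<inter> {v..w})"
      using that refl by (intro Var_ge_dist) auto
    then have "d (u v) (u w) + Var d u (S \<inter> {c..v}) \<le> Var d u (S \<inter> {c..v}) + Var d u (S \<inter> {v..w})"
      by (simp add: add.commute add_left_mono)
    also have "\<dots> \<le> Var d u (S \<inter> {c..w})"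
      using that by (intro Var_superadditive) auto
    finally show ?thesis .
  qed
  show "d (u v) (u w) + G v \<le> G w" if "v \<in> S \<inter> {x..z}" "w \<in> S \<inter> {x..z}" "v < w" for v w
  proof -
    consider "w \<le> y" | "v \<le> y" "y < w" | "y < v" by linarith
    then show ?thesis
    proof cases
      case 1
      then show ?thesis using that step[of v w x] by (auto simp: G_def)
    next
      case 2
      have "d (u v) (u w) + Var d u (S \<inter> {x..v})
          \<le> (d (u v) (u y) + d (u y) (u w)) + Var d u (S \<inter> {x..v})"
        by (intro add_right_mono tri)
      also have "\<dots> = (d (u v) (u y) + Var d u (S \<inter> {x..v})) + (d (u y) (u w) + 0)"
        by (simp add: ac_simps)
      also have "\<dots> \<le> Var d u (S \<inter> {x..y}) + Var d u (S \<inter> {y..w})"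
        using that 2 assms(3-5) refl
        by (intro add_mono step) (auto intro!: Var_ge_dist)
      finally show ?thesis using 2 by (simp add: G_def)
    next
      case 3
      then have "d (u v) (u w) + Var d u (S \<inter> {y..v}) \<le> Var d u (S \<inter> {y..w})"
        using that by (intro step) auto
      then have "Var d u (S \<inter> {x..y}) + (d (u v) (u w) + Var d u (S \<inter> {y..v}))
        \<le> Var d u (S \<inter> {x..y}) + Var d u (S \<inter> {y..w})" by (rule add_left_mono)
      then show ?thesis using that 3 by (simp add: G_def ac_simps)
    qed
  qed
  show "G w \<le> Var d u (S \<inter> {x..y}) + Var d u (S \<inter> {y..z})" if "w \<in> S \<inter> {x..z}" for w
  proof (cases "w \<le> y")
    case True
    then have "Var d u (S \<inter> {x..w}) \<le> Var d u (S \<inter> {x..y})" by (intro Var_mono) auto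
    then show ?thesis using True by (simp add: G_def add_increasing2)
  next
    case False
    have "Var d u (S \<inter> {y..w}) \<le> Var d u (S \<inter> {y..z})" using that by (intro Var_mono) auto
    then show ?thesis using False by (simp add: G_def add_left_mono)
  qed
qed

text \<open>Only \<open>a\<close> and \<open>b\<close> can occur in a partition, so a potential with
  a single jump after \<open>a\<close> suffices.\<close>

lemma Var_gap_le:
  assumes "S \<inter> {a<..<b} = {}" "a < b"
  shows "Var d u (S \<inter> {a..b}) \<le> d (u a) (u b)"
proof (rule Var_le_potential)
  show "d (u x) (u y) + (if x = a then 0 else d (u a) (u b)) \<le> (if y = a then 0 else d (u a) (u b))"
    if "x \<in> S \<inter> {a..b}" "y \<in> S \<inter> {a..b}" "x < y" for x y
  proof -
    have "x = a" "y = b" using that assms by (force simp: set_eq_iff)+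
    then show ?thesis using assms by simp
  qed
qed auto

section \<open>Compact sets of times\<close>

text \<open>Right-hand counterpart of \<open>pred_pt\<close>. At the maximum of \<open>S\<close> the
  infimum is over the empty set and its value has no meaning.\<close>

definition succ_pt :: "real set \<Rightarrow> real \<Rightarrow> real" where
  "succ_pt S a = Inf (S \<inter> {a<..})"

section \<open>Neighbouring points and holes of a compact set\<close>

context
  fixes S :: "real set"
  assumes S: "compact S"
begin

lemma compact_Inf_mem: "S \<noteq> {} \<Longrightarrow> Inf S \<in> S"
  and compact_Sup_mem: "S \<noteq> {} \<Longrightarrow> Sup S \<in> S"
  and compact_Inf_le: "x \<in> S \<Longrightarrow> Inf S \<le> x"
  and compact_le_Sup: "x \<in> S \<Longrightarrow> x \<le> Sup S"
  using S by (auto intro!: closed_contains_Inf closed_contains_Sup cInf_lower cSup_upper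
      simp: compact_eq_bounded_closed bounded_imp_bdd_below bounded_imp_bdd_above)

text \<open>The left neighbour is the supremum of the points below \<open>b\<close>. It lies in the
  closed set \<open>S\<close>, and it differs from \<open>b\<close> because \<open>S\<close> does
  not accumulate at \<open>b\<close> from the left.\<close>

lemma gap_below:
  assumes "x \<in> S" "x < b" "\<not> b islimpt (S \<inter> {..<b})"
  obtains a where "a \<in> S" "x \<le> a" "a < b" "S \<inter> {a<..<b} = {}"
proof
  define a where "a = Sup (S \<inter> {..<b})"
  have cl: "a \<in> closure (S \<inter> {..<b})"
    unfolding a_def using assms by (intro closure_contains_Sup) (auto intro: bdd_aboveI[of _ b])
  show "a \<in> S"
    using cl closure_minimal[of "S \<inter> {..<b}" S] compact_imp_closed[OF S] by auto
  show "a < b"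
  proof -
    have "a \<noteq> b" using cl assms(3) by (auto simp: closure_def)
    moreover have "a \<le> b" using cl closure_mono[of "S \<inter> {..<b}" "{..<b}"] by auto
    ultimately show ?thesis by simp
  qed
  show "x \<le> a"
    unfolding a_def using assms by (intro cSup_upper) (auto intro: bdd_aboveI[of _ b])
  show "S \<inter> {a<..<b} = {}"
    unfolding a_def using cSup_upper[of _ "S \<inter> {..<b}"] by (force intro: bdd_aboveI[of _ b])
qed

lemma gap_above:
  assumes "x \<in> S" "a < x" "\<not> a islimpt (S \<inter> {a<..})"
  obtains b where "b \<in> S" "b \<le> x" "a < b" "S \<inter> {a<..<b} = {}"
proof
  define b where "b = Inf (S \<inter> {a<..})"
  have cl: "b \<in> closure (S \<inter> {a<..})"
    unfolding b_def using assms by (intro closure_contains_Inf) (auto intro: bdd_belowI[of _ a])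
  show "b \<in> S"
    using cl closure_minimal[of "S \<inter> {a<..}" S] compact_imp_closed[OF S] by auto
  show "a < b"
  proof -
    have "a \<noteq> b" using cl assms(3) by (auto simp: closure_def)
    moreover have "a \<le> b" using cl closure_mono[of "S \<inter> {a<..}" "{a<..}"] by auto
    ultimately show ?thesis by simp
  qed
  show "b \<le> x"
    unfolding b_def using assms by (intro cInf_lower) (auto intro: bdd_belowI[of _ a])
  show "S \<inter> {a<..<b} = {}"
    unfolding b_def using cInf_lower[of _ "S \<inter> {a<..}"] by (force intro: bdd_belowI[of _ a])
qed

lemma succ_pt_eq:
  assumes "b \<in> S" "a < b" "S \<inter> {a<..<b} = {}"
  shows "succ_pt S a = b"
  unfolding succ_pt_def using assms by (intro cInf_eq_minimum) force+

lemma pred_pt_eq: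
  assumes "a \<in> S" "a < b" "S \<inter> {a<..<b} = {}"
  shows "pred_pt S b = a"
  unfolding pred_pt_def using assms compact_Inf_le by (intro cSup_eq_maximum) force+

lemma succ_pt_limit:
  assumes "a islimpt (S \<inter> {a<..})"
  shows "succ_pt S a = a"
  unfolding succ_pt_def
proof (rule cInf_eq_non_empty)
  show "S \<inter> {a<..} \<noteq> {}" using assms by (force simp: islimpt_EMPTY)
next
  fix y assume y: "\<And>x. x \<in> S \<inter> {a<..} \<Longrightarrow> y \<le> x"
  show "y \<le> a"
  proof (rule ccontr)
    assume "\<not> y \<le> a"
    with assms obtain x where "x \<in> S \<inter> {a<..}" "\<bar>x - a\<bar> < y - a"
      unfolding islimpt_approachable_real by (metis diff_gt_0_iff_gt not_le)
    with y[of x] show False by auto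
  qed
qed auto

text \<open>The point \<open>Inf S\<close> adjoined in \<open>pred_pt\<close> already belongs to
  \<open>S\<close> below \<open>b\<close>, so it does not affect the supremum.\<close>

lemma pred_pt_limit:
  assumes "b islimpt (S \<inter> {..<b})"
  shows "pred_pt S b = b"
proof -
  have ne: "S \<inter> {..<b} \<noteq> {}" using assms by (force simp: islimpt_EMPTY)
  then have "Inf S \<in> S \<inter> {..<b}"
    using compact_Inf_le compact_Inf_mem by force
  then have "pred_pt S b = Sup (S \<inter> {..<b})"
    by (simp add: pred_pt_def insert_absorb)
  also have "\<dots> = b"
  proof (rule cSup_eq_non_empty[OF ne])
    fix y assume y: "\<And>x. x \<in> S \<inter> {..<b} \<Longrightarrow> x \<le> y"
    show "b \<le> y"
    proof (rule ccontr)
      assume "\<not> b \<le> y"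
      with assms obtain x where "x \<in> S \<inter> {..<b}" "\<bar>x - b\<bar> < b - y"
        unfolding islimpt_approachable_real by (metis diff_gt_0_iff_gt not_le)
      with y[of x] show False by auto
    qed
  qed auto
  finally show ?thesis .
qed

text \<open>A point outside the closed set \<open>S\<close>, but between its extremes, has a nearest
  point of \<open>S\<close> on each side, and its component is the interval between them.\<close>

lemma holes_iff:
  assumes "S \<noteq> {}"
  shows "I \<in> holes S \<longleftrightarrow> (\<exists>a\<in>S. \<exists>b\<in>S. a < b \<and> S \<inter> {a<..<b} = {} \<and> I = {a<..<b})"
proof -
  have fwd: "\<exists>a\<in>S. \<exists>b\<in>S. a < b \<and> S \<inter> {a<..<b} = {} \<and> I = {a<..<b}"
    if I: "I \<in> holes S" for I
  proof -
    obtain x where x: "x \<in> I" using I in_components_nonempty unfolding holes_def by blast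
    have sub: "I \<subseteq> {Inf S..Sup S} - S" using I in_components_subset unfolding holes_def by blast
    have conn: "is_interval I"
      using I in_components_connected unfolding holes_def by (auto simp: is_interval_connected_1)
    have xS: "x \<notin> S" "Inf S \<le> x" "x \<le> Sup S" using x sub by auto
    with assms have "Inf S < x" "x < Sup S"
      using compact_Inf_mem compact_Sup_mem by (metis order.order_iff_strict)+
    moreover have "\<not> x islimpt S"
      using xS(1) compact_imp_closed[OF S] closed_limpt by blast
    ultimately obtain a b where
      a: "a \<in> S" "a < x" "S \<inter> {a<..<x} = {}" and b: "b \<in> S" "x < b" "S \<inter> {x<..<b} = {}"
      using gap_below[OF compact_Inf_mem[OF assms], of x] gap_above[OF compact_Sup_mem[OF assms], of x]
      by (metis inf_le1 islimpt_subset)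
    have gap: "S \<inter> {a<..<b} = {}"
      using a b xS(1) by (force simp: not_less_iff_gr_or_eq)
    have "{a<..<b} \<subseteq> I"
    proof (rule components_maximal)
      show "I \<in> components ({Inf S..Sup S} - S)" using I by (simp add: holes_def)
      show "{a<..<b} \<subseteq> {Inf S..Sup S} - S"
        using gap compact_Inf_le[OF a(1)] compact_le_Sup[OF b(1)] by force
      show "I \<inter> {a<..<b} \<noteq> {}" using x a b by auto
    qed auto
    moreover have "I \<subseteq> {a<..<b}"
    proof
      fix y assume y: "y \<in> I"
      have "\<not> y \<le> a" "\<not> b \<le> y"
        using conn y x a b sub unfolding is_interval_1 by (metis Diff_iff less_imp_le subsetD)+
      then show "y \<in> {a<..<b}" by simp
    qed
    ultimately show ?thesis using a b gap by (intro bexI[of _ a] bexI[of _ b]) auto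
  qed
  \<comment> \<open>The component of the midpoint is a gap by the first half. Two gaps with a common
    point coincide, since no endpoint of one lies inside the other.\<close>
  have "{a<..<b} \<in> holes S"
    if ab: "a \<in> S" "b \<in> S" "a < b" "S \<inter> {a<..<b} = {}" for a b
  proof -
    define x where "x = (a + b) / 2"
    have x: "a < x" "x < b" using ab by (auto simp: x_def)
    then have "x \<in> {Inf S..Sup S} - S"
      using ab compact_Inf_le[of a] compact_le_Sup[of b] by force
    then obtain I where I: "I \<in> holes S" "x \<in> I"
      unfolding holes_def using Union_components by blast
    then obtain a' b' where *: "a' \<in> S" "b' \<in> S" "S \<inter> {a'<..<b'} = {}" "I = {a'<..<b'}"
      using fwd by blast
    then have "a' < x" "x < b'" using I(2) by auto
    then have "a \<notin> {a'<..<b'}" "b \<notin> {a'<..<b'}" "a' \<notin> {a<..<b}" "b' \<notin> {a<..<b}"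
      using * ab by blast+
    then have "a' = a" "b' = b" using x \<open>a' < x\<close> \<open>x < b'\<close> by auto
    then show ?thesis using I(1) *(4) by blast
  qed
  then show ?thesis by (intro iffI) (erule fwd, elim bexE conjE, simp)
qed

lemma succ_ptE:
  assumes "a \<in> S" "a \<noteq> Sup S"
  obtains "a islimpt (S \<inter> {a<..})" "succ_pt S a = a"
  | "succ_pt S a \<in> S" "a < succ_pt S a" "S \<inter> {a<..<succ_pt S a} = {}"
proof (cases "a islimpt (S \<inter> {a<..})")
  case False
  have "Sup S \<in> S" "a < Sup S"
    using assms compact_Sup_mem compact_le_Sup[of a] by fastforce+
  with False obtain b where "b \<in> S" "a < b" "S \<inter> {a<..<b} = {}"
    using gap_above by blast
  with that(2) succ_pt_eq show ?thesis by metis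
qed (use that succ_pt_limit in blast)

lemma pred_ptE:
  assumes "b \<in> S" "b \<noteq> Inf S"
  obtains "b islimpt (S \<inter> {..<b})" "pred_pt S b = b"
  | "pred_pt S b \<in> S" "pred_pt S b < b" "S \<inter> {pred_pt S b<..<b} = {}"
proof (cases "b islimpt (S \<inter> {..<b})")
  case False
  have "Inf S \<in> S" "Inf S < b"
    using assms compact_Inf_mem compact_Inf_le[of b] by fastforce+
  with False obtain a where "a \<in> S" "a < b" "S \<inter> {a<..<b} = {}"
    using gap_below by blast
  with that(2) pred_pt_eq show ?thesis by metis
qed (use that pred_pt_limit in blast)

text \<open>Holes correspond to their left endpoints, and \<open>f x x = 0\<close> lets the sum run
  over all of \<open>S - {Sup S}\<close>. Both series in \<open>Trc\<close> thus get the same index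
  set.\<close>

lemma infsum_holes:
  fixes f :: "real \<Rightarrow> real \<Rightarrow> ennreal"
  assumes "S \<noteq> {}" "\<And>x. f x x = 0"
  shows "(\<Sum>\<^sub>\<infinity>I\<in>holes S. f (Inf I) (Sup I)) = (\<Sum>\<^sub>\<infinity>a\<in>S - {Sup S}. f a (succ_pt S a))"
proof -
  let ?A = "{a \<in> S - {Sup S}. a < succ_pt S a}"
  have "bij_betw (\<lambda>a. {a<..<succ_pt S a}) ?A (holes S)"
  proof (rule bij_betw_imageI)
    show "inj_on (\<lambda>a. {a<..<succ_pt S a}) ?A"
      by (rule inj_on_inverseI[of _ Inf]) auto
    show "(\<lambda>a. {a<..<succ_pt S a}) ` ?A = holes S"
    proof (intro set_eqI iffI)
      fix I assume "I \<in> (\<lambda>a. {a<..<succ_pt S a}) ` ?A"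
      then obtain a where "a \<in> S" "a \<noteq> Sup S" "a < succ_pt S a" "I = {a<..<succ_pt S a}" by auto
      then show "I \<in> holes S"
        using holes_iff[OF assms(1)] by (metis succ_ptE less_irrefl)
    next
      fix I assume "I \<in> holes S"
      then obtain a b where "a \<in> S" "b \<in> S" "a < b" "S \<inter> {a<..<b} = {}" "I = {a<..<b}"
        using holes_iff[OF assms(1)] by blast
      then show "I \<in> (\<lambda>a. {a<..<succ_pt S a}) ` ?A"
        using succ_pt_eq compact_le_Sup[of b] by (intro image_eqI[of _ _ a]) auto
    qed
  qed
  from infsum_reindex_bij_betw[OF this, of "\<lambda>I. f (Inf I) (Sup I)"]
  have "(\<Sum>\<^sub>\<infinity>I\<in>holes S. f (Inf I) (Sup I))
      = (\<Sum>\<^sub>\<infinity>a\<in>?A. f (Inf {a<..<succ_pt S a}) (Sup {a<..<succ_pt S a}))" by (rule sym)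
  also have "\<dots> = (\<Sum>\<^sub>\<infinity>a\<in>?A. f a (succ_pt S a))" by (rule infsum_cong) simp
  also have "\<dots> = (\<Sum>\<^sub>\<infinity>a\<in>S - {Sup S}. f a (succ_pt S a))"
    using assms(2) by (intro infsum_cong_neutral) (auto elim: succ_ptE)
  finally show ?thesis .
qed

text \<open>Going left from \<open>r\<^sub>1\<close>, a gap is crossed by \<open>gap\<close> and a limit point is left by \<open>limit\<close> unless
  the points just below it are all isolated; these are linked to it by gaps, and \<open>left\<close> passes to
  the limit along them.\<close>

lemma le_on_compact:
  fixes h :: "real \<Rightarrow> real"
  assumes gap: "\<And>a b. a \<in> S \<Longrightarrow> b \<in> S \<Longrightarrow> a < b \<Longrightarrow> S \<inter> {a<..<b} = {} \<Longrightarrow> h a \<le> h b"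
    and right: "\<And>a c. a \<in> S \<Longrightarrow> \<exists>\<^sub>F r in at a within (S \<inter> {a<..}). h r \<le> c \<Longrightarrow> h a \<le> c"
    and left: "\<And>b \<epsilon>. b \<in> S \<Longrightarrow> 0 < \<epsilon> \<Longrightarrow> \<forall>\<^sub>F q in at b within (S \<inter> {..<b}). h q \<le> h b + \<epsilon>"
    and limit: "\<And>b. b \<in> S \<Longrightarrow> \<forall>\<^sub>F q in at b within (S \<inter> {..<b}). q islimpt S \<longrightarrow> h q \<le> h b"
    and r: "r\<^sub>0 \<in> S" "r\<^sub>1 \<in> S" "r\<^sub>0 \<le> r\<^sub>1"
  shows "h r\<^sub>0 \<le> h r\<^sub>1"
proof (rule ccontr)
  assume neg: "\<not> h r\<^sub>0 \<le> h r\<^sub>1"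
  \<comment> \<open>The contradiction is derived at the first point \<open>a\<close> from
    \<open>r\<^sub>0\<close> on where \<open>h\<close> does not exceed
    \<open>h r\<^sub>1\<close>.\<close>
  define A where "A = {a \<in> S \<inter> {r\<^sub>0..r\<^sub>1}. h a \<le> h r\<^sub>1}"
  define a where "a = Inf A"
  have A: "r\<^sub>1 \<in> A" "bdd_below A" "A \<subseteq> S" using r by (auto simp: A_def)
  \<comment> \<open>Otherwise \<open>A\<close> would accumulate at \<open>a\<close> from the right,
    and \<open>right\<close> would put \<open>a\<close> into \<open>A\<close>.\<close>
  have aA: "a \<in> A"
  proof (rule ccontr)
    assume "a \<notin> A"
    have cl: "a \<in> closure A" unfolding a_def using A by (intro closure_contains_Inf) auto
    have aS: "a \<in> S" "r\<^sub>0 \<le> a" "a \<le> r\<^sub>1"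
    proof -
      have "closure A \<subseteq> S \<inter> {r\<^sub>0..r\<^sub>1}"
        using compact_imp_closed[OF S] by (intro closure_minimal) (auto simp: A_def)
      then show "a \<in> S" "r\<^sub>0 \<le> a" "a \<le> r\<^sub>1" using cl by auto
    qed
    have gt: "a < x" if "x \<in> A" for x
      using that \<open>a \<notin> A\<close> cInf_lower[OF that A(2)] by (auto simp: a_def less_le)
    have "\<exists>\<^sub>F r in at a within A. h r \<le> h r\<^sub>1"
      using cl \<open>a \<notin> A\<close>
      by (intro eventually_frequently) (auto simp: A_def eventually_at_filter trivial_limit_within closure_def)
    moreover have "at a within A \<le> at a within (S \<inter> {a<..})"
      using gt A(3) by (intro at_le) auto
    ultimately have "\<exists>\<^sub>F r in at a within (S \<inter> {a<..}). h r \<le> h r\<^sub>1"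
      unfolding frequently_def le_filter_def by blast
    then have "h a \<le> h r\<^sub>1" using right aS by blast
    with aS \<open>a \<notin> A\<close> show False by (simp add: A_def)
  qed
  then have aS: "a \<in> S" "r\<^sub>0 \<le> a" "a \<le> r\<^sub>1" "h a \<le> h r\<^sub>1" by (auto simp: A_def)
  then have "r\<^sub>0 < a" using neg by (auto simp: less_le)
  have below: "h r\<^sub>1 < h q" if "q \<in> S" "r\<^sub>0 \<le> q" "q < a" for q
    using that cInf_lower[OF _ A(2), of q] aS(3) by (force simp: a_def A_def)
  \<comment> \<open>An immediate predecessor of \<open>a\<close> would lie in \<open>A\<close> by
    \<open>gap\<close>, against the minimality of \<open>a\<close>.\<close>
  have acc: "a islimpt (S \<inter> {..<a})"
  proof (rule ccontr)
    assume "\<not> a islimpt (S \<inter> {..<a})"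
    then obtain p where "p \<in> S" "r\<^sub>0 \<le> p" "p < a" "S \<inter> {p<..<a} = {}"
      using gap_below r(1) \<open>r\<^sub>0 < a\<close> by blast
    then show False using gap[of p a] below[of p] aS by auto
  qed
  obtain \<eta> where \<eta>: "0 < \<eta>" "\<And>q. q \<in> S \<Longrightarrow> q < a \<Longrightarrow> a - \<eta> < q \<Longrightarrow> q islimpt S \<Longrightarrow> h q \<le> h a"
    using limit[OF aS(1)] unfolding eventually_at by (force simp: dist_real_def)
  obtain q where q: "q \<in> S" "q < a" "max (a - \<eta>) r\<^sub>0 < q"
    using acc \<eta>(1) \<open>r\<^sub>0 < a\<close> unfolding islimpt_approachable_real
    by (elim allE[of _ "min \<eta> (a - r\<^sub>0)"]) force
  \<comment> \<open>So close to \<open>a\<close>, a limit point of \<open>S\<close> would satisfy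
    both \<open>limit\<close> and the opposite strict inequality from \<open>below\<close>.\<close>
  have isolated: "\<not> x islimpt S" if "x \<in> S" "q \<le> x" "x < a" for x
    using \<eta>(2)[of x] below[of x] that q aS by force
  \<comment> \<open>The supremum of \<open>B\<close> is \<open>a\<close>: an earlier one would be
    isolated, hence in \<open>B\<close>, and \<open>gap\<close> would put its successor into
    \<open>B\<close> as well.\<close>
  define B where "B = {x \<in> S \<inter> {q..<a}. h q \<le> h x}"
  define s where "s = Sup B"
  have B: "q \<in> B" "bdd_above B" "B \<subseteq> S" "B \<subseteq> {q..a}"
    using q by (auto simp: B_def intro: bdd_aboveI[of _ a])
  have cl: "s \<in> closure B" unfolding s_def using B by (intro closure_contains_Sup) auto
  then have s: "s \<in> S" "q \<le> s" "s \<le> a"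
    using closure_minimal[of B S] closure_minimal[of B "{q..a}"] B compact_imp_closed[OF S] by auto
  have "s = a"
  proof (rule ccontr)
    assume "s \<noteq> a"
    then have "s < a" using s by simp
    then have iso: "\<not> s islimpt S" using isolated s by blast
    then have "s \<in> B" using cl B(3) islimpt_subset unfolding closure_def by blast
    obtain b where b: "b \<in> S" "b \<le> a" "s < b" "S \<inter> {s<..<b} = {}"
      using gap_above[OF aS(1) \<open>s < a\<close>] iso by (metis inf_le1 islimpt_subset)
    have "b \<noteq> a"
    proof
      assume "b = a"
      then have "S \<inter> {..<a} \<inter> {s<..} = {}" using b by auto
      with acc \<open>s < a\<close> show False
        unfolding islimpt_approachable_real by (elim allE[of _ "a - s"]) force
    qed
    then have "b \<in> B" using gap[of s b] b s \<open>s \<in> B\<close> by (auto simp: B_def)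
    then show False using cSup_upper[OF _ B(2), of b] b by (simp add: s_def)
  qed
  \<comment> \<open>Points of \<open>B\<close> close to \<open>a\<close> carry the bound
    \<open>h q \<le> h x\<close> over to \<open>a\<close> by \<open>left\<close>.\<close>
  have "h q \<le> h a + \<epsilon>" if "0 < \<epsilon>" for \<epsilon>
  proof -
    have "a islimpt B" using cl \<open>s = a\<close> by (auto simp: closure_def B_def)
    then have "at a within B \<noteq> bot" by (simp add: trivial_limit_within)
    moreover have "\<forall>\<^sub>F x in at a within B. h x \<le> h a + \<epsilon>"
      by (rule filter_leD[OF at_le left[OF aS(1) that]]) (auto simp: B_def)
    moreover have "\<forall>\<^sub>F x in at a within B. h q \<le> h x"
      by (auto simp: eventually_at_filter B_def)
    ultimately obtain x where "h x \<le> h a + \<epsilon>" "h q \<le> h x"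
      by (metis (mono_tags, lifting) eventually_conj eventually_happens')
    then show ?thesis by simp
  qed
  then have "h q \<le> h a" by (rule field_le_epsilon)
  with below[of q] q aS show False by auto
qed

end

section \<open>Transition cost\<close>

text \<open>By \<open>infsum_holes\<close> the holes are attached to their left endpoints; at the other points
  \<open>succ_pt S a = a\<close>, so that \<open>\<delta>\<close> contributes nothing.\<close>

definition atom_cost ::
    "('a \<Rightarrow> 'a \<Rightarrow> ennreal) \<Rightarrow> ('a \<Rightarrow> 'a \<Rightarrow> ennreal) \<Rightarrow> (real \<Rightarrow> 'a \<Rightarrow> real) \<Rightarrow>
     real \<Rightarrow> (real \<Rightarrow> 'a) \<Rightarrow> real set \<Rightarrow> real \<Rightarrow> ennreal" where
  "atom_cost d \<delta> \<E> t \<theta> S a = \<delta> (\<theta> a) (\<theta> (succ_pt S a)) + residual (D_of d \<delta>) \<E> t (\<theta> a)"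

text \<open>The index interval is half-open, so that cutting at a point of \<open>S\<close> counts
  every atom exactly once, in the piece to its right.\<close>

definition partial_cost ::
    "('a \<Rightarrow> 'a \<Rightarrow> ennreal) \<Rightarrow> ('a \<Rightarrow> 'a \<Rightarrow> ennreal) \<Rightarrow> (real \<Rightarrow> 'a \<Rightarrow> real) \<Rightarrow>
     real \<Rightarrow> (real \<Rightarrow> 'a) \<Rightarrow> real set \<Rightarrow> real \<Rightarrow> real \<Rightarrow> ennreal" where
  "partial_cost d \<delta> \<E> t \<theta> S r\<^sub>0 r\<^sub>1 =
     Var d \<theta> (S \<inter> {r\<^sub>0..r\<^sub>1}) + (\<Sum>\<^sub>\<infinity>a\<in>S \<inter> {r\<^sub>0..<r\<^sub>1}. atom_cost d \<delta> \<E> t \<theta> S a)"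

section \<open>Series in \<open>ennreal\<close> and the cost of adjacent pieces\<close>

lemma summable_on_ennreal [simp]: "(f :: 'b \<Rightarrow> ennreal) summable_on A"
  by (rule nonneg_summable_on_complete) simp

lemma sum_le_infsum_ennreal:
  fixes f :: "'b \<Rightarrow> ennreal"
  assumes "finite F" "F \<subseteq> A"
  shows "sum f F \<le> infsum f A"
  using assms by (subst nonneg_infsum_complete) (auto intro: SUP_upper)

text \<open>Otherwise arbitrarily many terms above \<open>Q\<close> would give finite partial sums
  larger than the whole sum.\<close>

lemma finite_above_infsum:
  fixes f :: "'b \<Rightarrow> ennreal"
  assumes "infsum f A < \<infinity>" "0 < Q"
  shows "finite {a \<in> A. ennreal Q < f a}"
proof (rule ccontr)
  assume inf: "infinite {a \<in> A. ennreal Q < f a}"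
  obtain c where c: "infsum f A = ennreal c" "0 \<le> c" using assms(1) by (cases "infsum f A") auto
  obtain n :: nat where n: "c / Q < real n" using reals_Archimedean2 by blast
  obtain F where F: "finite F" "card F = n" "F \<subseteq> {a \<in> A. ennreal Q < f a}"
    using infinite_arbitrarily_large[OF inf] by blast
  have "ennreal (real n * Q) = (\<Sum>a\<in>F. ennreal Q)"
    using F assms(2) by (simp add: ennreal_mult ennreal_of_nat_eq_real_of_nat)
  also have "\<dots> \<le> sum f F" using F by (intro sum_mono) auto
  also have "\<dots> \<le> ennreal c" unfolding c(1)[symmetric] using F by (intro sum_le_infsum_ennreal) auto
  finally show False using n c assms(2) by (simp add: ennreal_le_iff field_simps)
qed

lemma Trc_eq_partial_cost:
  assumes "compact S" "S \<noteq> {}" "\<And>x. \<delta> x x = 0"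
  shows "Trc d \<delta> \<E> t \<theta> S = partial_cost d \<delta> \<E> t \<theta> S (Inf S) (Sup S)"
proof -
  have "S \<inter> {Inf S..Sup S} = S" "S \<inter> {Inf S..<Sup S} = S - {Sup S}"
    using compact_Inf_le[OF assms(1)] compact_le_Sup[OF assms(1)] by (auto simp: less_le)
  then show ?thesis
    unfolding Trc_def partial_cost_def atom_cost_def
    using infsum_holes[OF assms(1,2), of "\<lambda>a b. \<delta> (\<theta> a) (\<theta> b)"] assms(3)
    by (simp add: infsum_add add.assoc)
qed

lemma partial_cost_superadditive:
  assumes "r\<^sub>1 \<in> S" "r\<^sub>0 \<le> r\<^sub>1" "r\<^sub>1 \<le> r\<^sub>2"
  shows "partial_cost d \<delta> \<E> t \<theta> S r\<^sub>0 r\<^sub>1 + partial_cost d \<delta> \<E> t \<theta> S r\<^sub>1 r\<^sub>2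
    \<le> partial_cost d \<delta> \<E> t \<theta> S r\<^sub>0 r\<^sub>2"
proof -
  let ?w = "atom_cost d \<delta> \<E> t \<theta> S"
  have "S \<inter> {r\<^sub>0..<r\<^sub>2} = (S \<inter> {r\<^sub>0..<r\<^sub>1}) \<union> (S \<inter> {r\<^sub>1..<r\<^sub>2})" using assms by auto
  then have "infsum ?w (S \<inter> {r\<^sub>0..<r\<^sub>2}) = infsum ?w (S \<inter> {r\<^sub>0..<r\<^sub>1}) + infsum ?w (S \<inter> {r\<^sub>1..<r\<^sub>2})"
    by (simp only:) (intro infsum_Un_disjoint, auto)
  then show ?thesis
    using add_right_mono[OF Var_superadditive[OF assms, of d \<theta>], of "infsum ?w (S \<inter> {r\<^sub>0..<r\<^sub>2})"]
    by (simp add: partial_cost_def ac_simps)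
qed

section \<open>Residual stability\<close>

text \<open>The residual is the least \<open>Q\<close> for which the point is quasi-stable, which
  lets (C.1) act on residuals. The competitor \<open>y = x\<close> makes the supremum nonnegative,
  so \<open>e2ennreal\<close> truncates nothing.\<close>

lemma residual_le_iff:
  assumes "D x x = 0" "0 \<le> Q"
  shows "residual D \<E> t x \<le> ennreal Q \<longleftrightarrow> quasi_stable D \<E> Q t x"
proof -
  define f where "f y = ereal (\<E> t x) - ereal (\<E> t y) - enn2ereal (D x y)" for y
  have "0 \<le> f x" using assms by (simp add: f_def zero_ennreal.rep_eq)
  then have nn: "0 \<le> (SUP y. f y)" by (meson SUP_upper UNIV_I order.trans)
  have "residual D \<E> t x \<le> ennreal Q \<longleftrightarrow> (SUP y. f y) \<le> ereal Q"
    unfolding residual_def f_def[symmetric] using nn assms(2)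
    by (metis e2ennreal_ereal e2ennreal_mono ennreal.abs_eq enn2ereal_e2ennreal enn2ereal_ennreal less_eq_ennreal.rep_eq)
  also have "\<dots> \<longleftrightarrow> (\<forall>y. f y \<le> ereal Q)" by (simp add: SUP_le_iff)
  also have "\<dots> \<longleftrightarrow> quasi_stable D \<E> Q t x"
    unfolding quasi_stable_def
  proof (intro all_cong1)
    fix y
    show "f y \<le> ereal Q \<longleftrightarrow> ereal (\<E> t x) \<le> ereal (\<E> t y) + enn2ereal (D x y) + ereal Q"
      unfolding f_def by (cases "D x y") (auto simp: algebra_simps)
  qed
  finally show ?thesis .
qed

lemma residual_energy_le:
  assumes "D x x = 0" "D x y < \<infinity>" "residual D \<E> t x < \<infinity>"
  shows "\<E> t x \<le> \<E> t y + enn2real (D x y) + enn2real (residual D \<E> t x)"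
proof -
  have "quasi_stable D \<E> (enn2real (residual D \<E> t x)) t x"
    using assms by (subst residual_le_iff[symmetric]) auto
  moreover obtain q where "D x y = ennreal q" "0 \<le> q" using assms(2) by (cases "D x y") auto
  ultimately show ?thesis unfolding quasi_stable_def by (auto dest!: spec[of _ y])
qed

text \<open>The infimum of \<open>\<E> t z + D x z\<close> over \<open>z\<close> is
  \<open>\<E> t x\<close> minus the residual. Minimality thus means that the energy drop pays
  exactly for \<open>D\<close> and the residual, and one inequality always holds.\<close>

lemma minimal_set_iff:
  assumes "D x x = 0"
  shows "y \<in> minimal_set D \<E> t x \<longleftrightarrow>
    \<E> t y \<le> \<E> t x \<and> D x y + residual D \<E> t x \<le> ennreal (\<E> t x - \<E> t y)"
proof (cases "D x y")
  case (real q)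
  define Q where "Q = \<E> t x - \<E> t y - q"
  have "y \<in> minimal_set D \<E> t x \<longleftrightarrow> (\<forall>z. ereal (\<E> t y) + ereal q \<le> ereal (\<E> t z) + enn2ereal (D x z))"
    using real by (auto simp: minimal_set_def is_arg_min_def not_less)
  also have "\<dots> \<longleftrightarrow> quasi_stable D \<E> Q t x"
    unfolding quasi_stable_def Q_def
  proof (intro all_cong1)
    fix z
    show "ereal (\<E> t y) + ereal q \<le> ereal (\<E> t z) + enn2ereal (D x z) \<longleftrightarrow>
      ereal (\<E> t x) \<le> ereal (\<E> t z) + enn2ereal (D x z) + ereal (\<E> t x - \<E> t y - q)"
      by (cases "D x z") auto
  qed
  also have "\<dots> \<longleftrightarrow> 0 \<le> Q \<and> quasi_stable D \<E> Q t x"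
    using assms by (auto simp: quasi_stable_def zero_ennreal.rep_eq dest: spec[of _ x])
  also have "\<dots> \<longleftrightarrow> 0 \<le> Q \<and> residual D \<E> t x \<le> ennreal Q"
    using residual_le_iff[of D x Q \<E> t] assms by auto
  also have "\<dots> \<longleftrightarrow> \<E> t y \<le> \<E> t x \<and> ennreal q + residual D \<E> t x \<le> ennreal (\<E> t x - \<E> t y)"
    using \<open>0 \<le> q\<close> unfolding Q_def
    by (cases "residual D \<E> t x") (auto simp flip: ennreal_plus simp: top_unique)
  finally show ?thesis using real by simp
next
  \<comment> \<open>The point \<open>x\<close> competes with a finite value, so an infinite
    \<open>D x y\<close> rules out minimality.\<close>
  case top
  then show ?thesis
    using assms by (auto simp: minimal_set_def is_arg_min_def top_unique intro!: exI[of _ x])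
qed

lemma lsc_on_compose:
  assumes "lsc_on A g" "continuous_on B f" "f ` B \<subseteq> A"
  shows "lsc_on B (\<lambda>x. g (f x))"
  unfolding lsc_on_def
proof (intro ballI allI impI)
  fix x c assume x: "x \<in> B" "c < g (f x)"
  then obtain U where U: "open U" "f x \<in> U" "\<And>y. y \<in> U \<Longrightarrow> y \<noteq> f x \<Longrightarrow> y \<in> A \<Longrightarrow> c < g y"
    using assms(1,3) unfolding lsc_on_def eventually_at_topological by (metis image_subset_iff)
  have "\<forall>\<^sub>F y in at x within B. f y \<in> U"
    using assms(2) x U unfolding continuous_on_def by (blast dest: topological_tendstoD)
  moreover have "\<forall>\<^sub>F y in at x within B. y \<in> B" by (simp add: eventually_at_filter)
  ultimately show "\<forall>\<^sub>F y in at x within B. c < g (f y)"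
  proof eventually_elim
    case (elim y)
    \<comment> \<open>Punctured neighbourhoods ignore \<open>f x\<close>, but \<open>f y\<close> may
      equal it; the bound then holds by assumption.\<close>
    then show ?case using U(3)[of "f y"] x assms(3) by (cases "f y = f x") auto
  qed
qed

section \<open>Energy estimates\<close>

locale ve_space =
  fixes T F\<^sub>o :: real
    and x\<^sub>o :: "'a::{t2_space,first_countable_topology}"
    and d \<delta> :: "'a \<Rightarrow> 'a \<Rightarrow> ennreal"
    and \<E> \<P> :: "real \<Rightarrow> 'a \<Rightarrow> real"
  assumes setting: "ve_setting T x\<^sub>o d \<delta> \<E> F\<^sub>o"
    and A: "assumption_A T x\<^sub>o d \<E> F\<^sub>o \<P>"
    and B: "assumption_B T x\<^sub>o d \<delta> \<E> F\<^sub>o"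
    and C: "assumption_C T x\<^sub>o d \<delta> \<E> F\<^sub>o"
begin

abbreviation "\<F> \<equiv> augmented_energy d x\<^sub>o F\<^sub>o \<E>"
abbreviation "D \<equiv> D_of d \<delta>"

lemma d_refl: "d x x = 0"
  and d_triangle: "d x z \<le> d x y + d y z"
  and d_finite: "d x\<^sub>o x < \<infinity>"
  and \<delta>_refl: "\<delta> x x = 0"
  and D_refl: "D x x = 0"
  and F_nonneg: "t \<in> {0..T} \<Longrightarrow> 0 \<le> \<F> t x"
  using setting
  by (auto simp: ve_setting_def asym_quasi_distance_def viscous_correction_def D_of_def)

lemma energy_lsc: "lsc_on (sublevel T \<F> c) (\<lambda>(t, x). \<E> t x)"
  using A by (simp add: assumption_A_def Let_def)

text \<open>A Gronwall argument backwards in time: by (A.2) the lower left derivative of the energy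
  is at least \<open>- C * \<F>\<close>, so \<open>\<F> + 1\<close> times \<open>exp (C * s)\<close>
  is nondecreasing. Monotonicity is obtained from one-sided conditions through
  \<open>le_on_compact\<close>.\<close>

lemma initial_energy_bound:
  assumes t: "t \<in> {0..T}"
  obtains K where "0 < K" "\<And>x. \<F> 0 x \<le> K * (\<F> t x + 1)"
proof -
  obtain C where C: "0 < C" "\<And>s x. s \<in> {0..T} \<Longrightarrow>
      Liminf (at s within {0..<s}) (\<lambda>r. ereal ((\<E> s x - \<E> r x) / (s - r))) \<ge> ereal (\<P> s x)
      \<and> \<bar>\<P> s x\<bar> \<le> C * \<F> s x"
    using A unfolding assumption_A_def Let_def by blast
  have "\<F> 0 x \<le> exp (C * t) * (\<F> t x + 1)" for x
  proof -
    define h where "h s = (\<F> s x + 1) * exp (C * s)" for s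
    have step: "\<forall>\<^sub>F q in at b within ({0..t} \<inter> {..<b}). h q \<le> h b" if b: "b \<in> {0..t}" for b
    proof -
      have bT: "b \<in> {0..T}" using b t by auto
      \<comment> \<open>The summand \<open>1\<close> makes the inequality strict, as needed to pass
        from the \<open>Liminf\<close> to nearby times.\<close>
      have "ereal (- C * (\<F> b x + 1)) < ereal (\<P> b x)"
        using C(1) C(2)[OF bT, of x] by (auto simp: algebra_simps)
      also have "\<dots> \<le> Liminf (at b within {0..<b}) (\<lambda>r. ereal ((\<E> b x - \<E> r x) / (b - r)))"
        using C(2)[OF bT, of x] by blast
      finally have "\<forall>\<^sub>F r in at b within {0..<b}. - C * (\<F> b x + 1) < (\<E> b x - \<E> r x) / (b - r)"
        by (auto dest: less_LiminfD)
      moreover have "\<forall>\<^sub>F r in at b within {0..<b}. r < b" by (simp add: eventually_at_filter)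
      ultimately have "\<forall>\<^sub>F r in at b within {0..<b}. h r \<le> h b"
      proof eventually_elim
        case (elim r)
        have "\<F> r x + 1 \<le> (\<F> b x + 1) * (1 + C * (b - r))"
          using elim by (simp add: augmented_energy_def field_simps)
        also have "\<dots> \<le> (\<F> b x + 1) * exp (C * (b - r))"
          using F_nonneg[OF bT, of x] by (intro mult_left_mono exp_ge_add_one_self) auto
        finally have "h r \<le> (\<F> b x + 1) * exp (C * (b - r)) * exp (C * r)"
          unfolding h_def by (intro mult_right_mono) auto
        also have "\<dots> = h b" by (simp add: h_def mult.assoc right_diff_distrib flip: exp_add)
        finally show ?case .
      qed
      moreover have "{0..t} \<inter> {..<b} = {0..<b}" using b by auto
      ultimately show ?thesis by simp
    qed
    have "h 0 \<le> h t"
    proof (rule le_on_compact[of "{0..t}" h])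
      fix a b assume ab: "a \<in> {0..t}" "b \<in> {0..t}" "a < b" "{0..t} \<inter> {a<..<b} = {}"
      have "(a + b) / 2 \<in> {0..t} \<inter> {a<..<b}" using ab(1-3) by auto
      then show "h a \<le> h b" using ab(4) by blast
    next
      fix a c assume a: "a \<in> {0..t}" and fr: "\<exists>\<^sub>F r in at a within ({0..t} \<inter> {a<..}). h r \<le> c"
      show "h a \<le> c"
      proof (rule ccontr)
        assume neg: "\<not> h a \<le> c"
        \<comment> \<open>\<open>B\<close> contains \<open>a\<close>, and every \<open>r\<close>
          with \<open>h r \<le> c\<close> because \<open>\<F> r x \<le> h r\<close>, so lower
          semicontinuity on one sublevel applies. The level \<open>c'\<close> is chosen so that
          \<open>c' < \<E> a x\<close> expresses \<open>c < h a\<close>.\<close>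
        define B where "B = {s \<in> {0..T}. \<F> s x \<le> max c (\<F> a x)}"
        define c' where "c' = c * exp (- (C * a)) - 1 - enn2real (d x\<^sub>o x) - F\<^sub>o"
        have "lsc_on B (\<lambda>s. (case (s, x) of (t, x) \<Rightarrow> \<E> t x))"
          by (rule lsc_on_compose[OF energy_lsc]) (auto simp: B_def sublevel_def intro!: continuous_intros)
        moreover have "c' < \<E> a x" "a \<in> B"
          using neg a t by (auto simp: c'_def h_def B_def exp_minus field_simps augmented_energy_def)
        ultimately have "\<forall>\<^sub>F r in at a within B. c' < \<E> r x" by (auto simp: lsc_on_def)
        then have "\<forall>\<^sub>F r in at a within ({0..t} \<inter> {a<..}). (r \<in> B \<longrightarrow> c' < \<E> r x) \<and> r \<in> {0..t} \<and> a < r"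
          unfolding eventually_at_filter by eventually_elim auto
        then have "\<forall>\<^sub>F r in at a within ({0..t} \<inter> {a<..}).
            h r \<le> c \<longrightarrow> h r \<le> c \<and> (r \<in> B \<longrightarrow> c' < \<E> r x) \<and> r \<in> {0..t} \<and> a < r"
          by eventually_elim simp
        from frequently_rev_mp[OF fr this]
        obtain r where r: "h r \<le> c" "r \<in> B \<longrightarrow> c' < \<E> r x" "r \<in> {0..t}" "a < r"
          using frequently_ex by blast
        have rT: "r \<in> {0..T}" using r t by auto
        have F: "0 \<le> \<F> r x" by (rule F_nonneg[OF rT])
        have "1 \<le> exp (C * r)" using C(1) r(3) by auto
        with F have "(\<F> r x + 1) * 1 \<le> h r" unfolding h_def by (intro mult_left_mono) auto
        then have "\<F> r x \<le> h r" by simp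
        then have "c' < \<E> r x" using r rT by (auto simp: B_def)
        then have "c * exp (- (C * a)) < \<F> r x + 1" by (simp add: c'_def augmented_energy_def)
        then have "c < (\<F> r x + 1) * exp (C * a)" by (simp add: exp_minus field_simps)
        also have "\<dots> \<le> h r" unfolding h_def using F C(1) r(4) by (intro mult_left_mono) auto
        finally show False using r(1) by simp
      qed
    next
      fix b \<epsilon> :: real assume "b \<in> {0..t}" "0 < \<epsilon>"
      from step[OF this(1)] this(2)
      show "\<forall>\<^sub>F q in at b within ({0..t} \<inter> {..<b}). h q \<le> h b + \<epsilon>" by (auto elim: eventually_mono)
    next
      fix b assume "b \<in> {0..t}"
      from step[OF this]
      show "\<forall>\<^sub>F q in at b within ({0..t} \<inter> {..<b}). q islimpt {0..t} \<longrightarrow> h q \<le> h b" 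
        by (auto elim: eventually_mono)
    qed (use t in auto)
    then show ?thesis by (simp add: h_def mult.commute)
  qed
  then show ?thesis using that[of "exp (C * t)"] by simp
qed

end

text \<open>Finiteness of the cost is left to \<open>ve_finite_curve\<close>, since in the converse
  direction it is a conclusion. Confinement to one sublevel is common to both directions.\<close>

locale ve_curve = ve_space +
  fixes t C\<^sub>\<theta> :: real and \<theta> :: "real \<Rightarrow> 'a" and S :: "real set"
  assumes t: "t \<in> {0..T}"
    and compact: "compact S" and nonempty: "S \<noteq> {}"
    and curve: "\<theta> \<in> C_curves d S"
    and bounded: "\<And>s. s \<in> S \<Longrightarrow> \<F> t (\<theta> s) \<le> C\<^sub>\<theta>"
begin

section \<open>Limits along a curve confined to a sublevel\<close>

lemma continuous: "continuous_on S \<theta>"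
  using curve by (simp add: C_curves_def)

lemma energy_lsc_along: "lsc_on S (\<lambda>s. \<E> t (\<theta> s))"
proof -
  have "lsc_on S (\<lambda>s. (case (t, \<theta> s) of (t, x) \<Rightarrow> \<E> t x))"
    by (rule lsc_on_compose[OF energy_lsc[of C\<^sub>\<theta>]])
      (use t bounded in \<open>auto simp: sublevel_def intro!: continuous_intros continuous\<close>)
  then show ?thesis by simp
qed

text \<open>This is the closedness in (C.1), transported along the continuous map
  \<open>s \<mapsto> (t, \<theta> s)\<close>.\<close>

lemma quasi_stable_at_limit:
  assumes p: "p \<in> S" and Q: "0 \<le> Q"
    and fr: "\<exists>\<^sub>F q in at p within S. quasi_stable D \<E> Q t (\<theta> q)"
  shows "quasi_stable D \<E> Q t (\<theta> p)"
proof (rule ccontr)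
  assume neg: "\<not> quasi_stable D \<E> Q t (\<theta> p)"
  define K where "K = quasi_stable_set T D \<E> Q \<inter> sublevel T \<F> C\<^sub>\<theta>"
  have K: "(t, \<theta> s) \<in> K \<longleftrightarrow> quasi_stable D \<E> Q t (\<theta> s)" if "s \<in> S" for s
    using t bounded[OF that] by (simp add: K_def quasi_stable_set_def sublevel_def)
  have "closed K" using C Q by (simp add: assumption_C_def K_def)
  moreover have "((\<lambda>s. (t, \<theta> s)) \<longlongrightarrow> (t, \<theta> p)) (at p within S)"
    using continuous p by (intro tendsto_intros) (auto simp: continuous_on_def)
  moreover have "(t, \<theta> p) \<in> - K" using neg K p by simp
  ultimately have "\<forall>\<^sub>F s in at p within S. (t, \<theta> s) \<in> - K"
    by (intro topological_tendstoD) auto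
  moreover have "\<forall>\<^sub>F s in at p within S. s \<in> S" by (simp add: eventually_at_filter)
  ultimately have "\<forall>\<^sub>F s in at p within S. \<not> quasi_stable D \<E> Q t (\<theta> s)"
    by eventually_elim (simp add: K)
  with fr show False by (simp add: frequently_def)
qed

text \<open>\<open>quasi_stable_at_limit\<close> applies for every positive \<open>Q\<close>, which
  then tends to \<open>0\<close>. Smallness is asked only frequently, as this is what the proof of
  \<open>residual_at_right_limit\<close> provides.\<close>

lemma residual_at_limit:
  assumes p: "p \<in> S"
    and fr: "\<And>Q. 0 < Q \<Longrightarrow> \<exists>\<^sub>F q in at p within S. residual D \<E> t (\<theta> q) \<le> ennreal Q"
  shows "residual D \<E> t (\<theta> p) = 0"
proof -
  have "residual D \<E> t (\<theta> p) \<le> ennreal Q" if Q: "0 < Q" for Q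
    using quasi_stable_at_limit[OF p less_imp_le[OF Q]] fr[OF Q]
    unfolding residual_le_iff[of D, OF D_refl less_imp_le[OF Q]] .
  then have "residual D \<E> t (\<theta> p) \<le> 0" by - (rule ennreal_le_epsilon, simp)
  then show ?thesis by simp
qed

lemma dist_left_limit:
  assumes "p \<in> S" "0 < \<epsilon>"
  shows "\<forall>\<^sub>F q in at p within (S \<inter> {..<p}). d (\<theta> q) (\<theta> p) \<le> ennreal \<epsilon>"
proof -
  obtain \<eta> where \<eta>: "0 < \<eta>"
    "\<And>q. q \<in> S \<Longrightarrow> q \<le> p \<Longrightarrow> p \<le> q + \<eta> \<Longrightarrow> d (\<theta> q) (\<theta> p) \<le> ennreal \<epsilon>"
    using curve assms unfolding C_curves_def by simp metis
  show ?thesis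
    unfolding eventually_at using \<eta> by (intro exI[of _ \<eta>]) (auto simp: dist_real_def)
qed

text \<open>(B.2) is sequential and asks for a bound on \<open>\<F> 0\<close>, whereas the curve is
  bounded in \<open>\<F> t\<close>; \<open>initial_energy_bound\<close> converts one into the
  other.\<close>

lemma \<delta>_left_limit:
  assumes p: "p \<in> S"
  shows "((\<lambda>q. \<delta> (\<theta> q) (\<theta> p)) \<longlongrightarrow> 0) (at p within (S \<inter> {..<p}))"
  unfolding tendsto_at_iff_sequentially
proof (intro allI impI)
  fix X assume X: "\<forall>n. X n \<in> S \<inter> {..<p} - {p}" "X \<longlonglongrightarrow> p"
  then have X_at: "filterlim X (at p within (S \<inter> {..<p})) sequentially"
    by (simp add: filterlim_at less_imp_neq)
  obtain K where K: "0 < K" "\<And>x. \<F> 0 x \<le> K * (\<F> t x + 1)"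
    using initial_energy_bound[OF t] by blast
  have "\<F> 0 (\<theta> (X n)) \<le> K * (C\<^sub>\<theta> + 1)" for n
  proof -
    have "\<F> t (\<theta> (X n)) \<le> C\<^sub>\<theta>" using bounded X by simp
    then have "K * (\<F> t (\<theta> (X n)) + 1) \<le> K * (C\<^sub>\<theta> + 1)" using K(1) by (intro mult_left_mono) auto
    with K(2)[of "\<theta> (X n)"] show ?thesis by (rule order.trans)
  qed
  then have "bdd_above (range (\<lambda>n. \<F> 0 ((\<theta> \<circ> X) n)))" by (intro bdd_aboveI2) simp
  moreover have "(\<theta> \<circ> X) \<longlonglongrightarrow> \<theta> p"
    using continuous p X unfolding continuous_on_sequentially by auto
  moreover have "(\<lambda>n. d ((\<theta> \<circ> X) n) (\<theta> p)) \<longlonglongrightarrow> 0"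
  proof (rule order_tendstoI)
    fix a :: ennreal assume "0 < a"
    then obtain b where b: "0 < b" "b < a" using dense by blast
    then obtain \<epsilon> where \<epsilon>: "b = ennreal \<epsilon>" "0 < \<epsilon>" by (cases b) (auto simp: top_unique)
    have "\<forall>\<^sub>F n in sequentially. d (\<theta> (X n)) (\<theta> p) \<le> ennreal \<epsilon>"
      using dist_left_limit[OF p \<epsilon>(2)] X_at unfolding filterlim_iff by blast
    then show "\<forall>\<^sub>F n in sequentially. d ((\<theta> \<circ> X) n) (\<theta> p) < a"
      by eventually_elim (use b \<epsilon> in auto)
  qed auto
  ultimately show "((\<lambda>q. \<delta> (\<theta> q) (\<theta> p)) \<circ> X) \<longlonglongrightarrow> 0"
    using B unfolding assumption_B_def Let_def by (auto simp: o_def)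
qed

section \<open>Cost of a portion of the curve\<close>

abbreviation "cost_between \<equiv> partial_cost d \<delta> \<E> t \<theta> S"

lemma cost_between_ge_Var: "Var d \<theta> (S \<inter> {r\<^sub>0..r\<^sub>1}) \<le> cost_between r\<^sub>0 r\<^sub>1"
  by (simp add: partial_cost_def)

lemma cost_between_ge_dist:
  assumes "a \<in> S" "b \<in> S" "a \<le> b"
  shows "d (\<theta> a) (\<theta> b) \<le> cost_between a b"
  using Var_ge_dist[of a "S \<inter> {a..b}" b d \<theta>] assms d_refl cost_between_ge_Var[of a b]
  by (auto intro: order.trans)

text \<open>The only atom in \<open>{a..<b}\<close> is \<open>a\<close>, and its successor is
  \<open>b\<close>.\<close>

lemma cost_between_gap:
  assumes "a \<in> S" "b \<in> S" "a < b" "S \<inter> {a<..<b} = {}"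
  shows "D (\<theta> a) (\<theta> b) + residual D \<E> t (\<theta> a) \<le> cost_between a b"
proof -
  have "succ_pt S a = b" using assms by (intro succ_pt_eq[OF compact])
  moreover have "S \<inter> {a..<b} = {a}" using assms by force
  ultimately have "D (\<theta> a) (\<theta> b) + residual D \<E> t (\<theta> a)
      = d (\<theta> a) (\<theta> b) + (\<Sum>\<^sub>\<infinity>s\<in>S \<inter> {a..<b}. atom_cost d \<delta> \<E> t \<theta> S s)"
    by (simp add: atom_cost_def D_of_def add.assoc)
  also have "\<dots> \<le> cost_between a b"
    unfolding partial_cost_def using assms d_refl
    by (intro add_right_mono Var_ge_dist) auto
  finally show ?thesis .
qed

end

locale ve_finite_curve = ve_curve +
  assumes finite_cost: "Trc d \<delta> \<E> t \<theta> S < \<infinity>"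
begin

text \<open>The residuals have a finite sum, so only finitely many exceed \<open>Q\<close>, and a
  finite set does not accumulate at \<open>p\<close>.\<close>

lemma residual_near:
  assumes "0 < Q"
  shows "\<forall>\<^sub>F q in at p within S. residual D \<E> t (\<theta> q) \<le> ennreal Q"
proof -
  have "(\<Sum>\<^sub>\<infinity>s\<in>S - {Sup S}. residual D \<E> t (\<theta> s)) < \<infinity>"
    using finite_cost by (simp add: Trc_def)
  from finite_above_infsum[OF this assms]
  \<comment> \<open>\<open>Trc\<close> does not count the residual at \<open>Sup S\<close>, so this
    point joins the exceptional set.\<close>
  have "finite (insert (Sup S) {a \<in> S - {Sup S}. ennreal Q < residual D \<E> t (\<theta> a)})" (is "finite ?F")
    by simp
  then have "open (- (?F - {p}))" by (intro open_Compl finite_imp_closed) auto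
  then show ?thesis
    unfolding eventually_at_topological by (intro exI[of _ "- (?F - {p})"]) auto
qed

lemma stable_at_limit:
  assumes "p \<in> S" "p islimpt S"
  shows "residual D \<E> t (\<theta> p) = 0"
  using assms residual_near
  by (intro residual_at_limit eventually_frequently) (auto simp: trivial_limit_within)

text \<open>This is \<open>\<tau>\<close> as a real number; by \<open>cost_between_finite\<close>
  the conversion loses nothing on \<open>S\<close>.\<close>

definition cost_to :: "real \<Rightarrow> real" where
  "cost_to r = enn2real (cost_between (Inf S) r)"

lemma cost_between_finite:
  assumes "r \<in> S"
  shows "cost_between (Inf S) r = ennreal (cost_to r)"
proof -
  have "cost_between (Inf S) r \<le> cost_between (Inf S) r + cost_between r (Sup S)" by simp
  also have "\<dots> \<le> cost_between (Inf S) (Sup S)"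
    using assms compact_Inf_le[OF compact] compact_le_Sup[OF compact]
    by (intro partial_cost_superadditive) auto
  also have "\<dots> = Trc d \<delta> \<E> t \<theta> S"
    using Trc_eq_partial_cost[of S \<delta>] compact nonempty \<delta>_refl by simp
  finally have "cost_between (Inf S) r < \<infinity>" using finite_cost by order
  then show ?thesis by (simp add: cost_to_def)
qed

lemma cost_to_Inf: "cost_to (Inf S) = 0"
proof -
  have "S \<inter> {Inf S} = {Inf S}" using compact_Inf_mem[OF compact nonempty] by auto
  then show ?thesis by (simp add: cost_to_def partial_cost_def Var_singleton)
qed

lemma Trc_eq_cost_to: "Trc d \<delta> \<E> t \<theta> S = ennreal (cost_to (Sup S))"
  using Trc_eq_partial_cost[of S \<delta>] compact nonempty \<delta>_refl
    cost_between_finite compact_Sup_mem by simp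

lemma cost_to_nonneg: "0 \<le> cost_to r"
  by (simp add: cost_to_def)

text \<open>Superadditivity suffices, since the energy estimates only need increments of
  \<open>cost_to\<close> to be large enough.\<close>

lemma cost_to_diff:
  assumes "r\<^sub>0 \<in> S" "r\<^sub>1 \<in> S" "r\<^sub>0 \<le> r\<^sub>1"
  shows "cost_between r\<^sub>0 r\<^sub>1 \<le> ennreal (cost_to r\<^sub>1 - cost_to r\<^sub>0)" "cost_to r\<^sub>0 \<le> cost_to r\<^sub>1"
proof -
  have *: "ennreal (cost_to r\<^sub>0) + cost_between r\<^sub>0 r\<^sub>1 \<le> ennreal (cost_to r\<^sub>1)"
    using partial_cost_superadditive[of r\<^sub>0 S "Inf S" r\<^sub>1 d \<delta> \<E> t \<theta>] assms compact_Inf_le[OF compact]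
    by (simp add: cost_between_finite)
  then obtain c where c: "cost_between r\<^sub>0 r\<^sub>1 = ennreal c" "0 \<le> c"
    by (cases "cost_between r\<^sub>0 r\<^sub>1") (auto simp: top_unique)
  with * show "cost_between r\<^sub>0 r\<^sub>1 \<le> ennreal (cost_to r\<^sub>1 - cost_to r\<^sub>0)" "cost_to r\<^sub>0 \<le> cost_to r\<^sub>1"
    using cost_to_nonneg by (auto simp: ennreal_le_iff simp flip: ennreal_plus)
qed

text \<open>Across a gap the energy drops by at most \<open>D\<close> plus the residual, and the
  increment of the cost contains both.\<close>

lemma gap_estimate:
  assumes "a \<in> S" "b \<in> S" "a < b" "S \<inter> {a<..<b} = {}"
  shows "\<E> t (\<theta> a) + cost_to a \<le> \<E> t (\<theta> b) + cost_to b"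
proof -
  have le: "D (\<theta> a) (\<theta> b) + residual D \<E> t (\<theta> a) \<le> ennreal (cost_to b - cost_to a)"
    using cost_between_gap[OF assms] cost_to_diff(1)[of a b] assms by auto
  then obtain q R where "D (\<theta> a) (\<theta> b) = ennreal q" "0 \<le> q" "residual D \<E> t (\<theta> a) = ennreal R" "0 \<le> R"
    by (cases "D (\<theta> a) (\<theta> b)"; cases "residual D \<E> t (\<theta> a)") (auto simp: top_unique)
  with le residual_energy_le[of D "\<theta> a" "\<theta> b" \<E> t, OF D_refl] cost_to_diff(2)[of a b] assms
  show ?thesis by (auto simp: ennreal_le_iff simp flip: ennreal_plus)
qed

text \<open>The energy at \<open>q\<close> exceeds that at \<open>p\<close> by at most
  \<open>d\<close>, \<delta> and the residual at \<open>q\<close>, which all tend to zero as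
  \<open>q\<close> approaches \<open>p\<close> from the left.\<close>

lemma energy_left_usc:
  assumes p: "p \<in> S" and \<epsilon>: "0 < \<epsilon>"
  shows "\<forall>\<^sub>F q in at p within (S \<inter> {..<p}). \<E> t (\<theta> q) \<le> \<E> t (\<theta> p) + \<epsilon>"
proof -
  have "\<forall>\<^sub>F q in at p within (S \<inter> {..<p}). d (\<theta> q) (\<theta> p) \<le> ennreal (\<epsilon> / 3)"
    using dist_left_limit p \<epsilon> by simp
  moreover have "\<forall>\<^sub>F q in at p within (S \<inter> {..<p}). \<delta> (\<theta> q) (\<theta> p) < ennreal (\<epsilon> / 3)"
    using \<delta>_left_limit[OF p] \<epsilon> by (intro order_tendstoD(2)) auto
  moreover have "\<forall>\<^sub>F q in at p within (S \<inter> {..<p}). residual D \<E> t (\<theta> q) \<le> ennreal (\<epsilon> / 3)"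
    using residual_near[of "\<epsilon> / 3" p] \<epsilon> by (auto intro: filter_leD[OF at_le])
  ultimately show ?thesis
  proof eventually_elim
    case (elim q)
    have "D (\<theta> q) (\<theta> p) \<le> ennreal (\<epsilon> / 3) + ennreal (\<epsilon> / 3)"
      unfolding D_of_def using elim by (intro add_mono) auto
    also have "\<dots> = ennreal (2 * \<epsilon> / 3)" using \<epsilon> by (simp flip: ennreal_plus)
    finally have D: "D (\<theta> q) (\<theta> p) \<le> ennreal (2 * \<epsilon> / 3)" .
    have "D (\<theta> q) (\<theta> p) < \<infinity>" "residual D \<E> t (\<theta> q) < \<infinity>"
      using D elim(3) by (auto simp: less_top[symmetric] top_unique)
    moreover have "enn2real (D (\<theta> q) (\<theta> p)) \<le> 2 * \<epsilon> / 3" "enn2real (residual D \<E> t (\<theta> q)) \<le> \<epsilon> / 3"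
      using enn2real_leI[OF _ D] enn2real_leI[OF _ elim(3)] \<epsilon> by simp_all
    ultimately show ?case
      using residual_energy_le[of D "\<theta> q" "\<theta> p" \<E> t, OF D_refl] by auto
  qed
qed

text \<open>Limit points of \<open>S\<close> are stable, so (B.3) applies with both points at time
  \<open>t\<close>. The distance in it is at most the increment of \<open>cost_to\<close>, and
  weighting the cost by \<open>M\<close> absorbs the factor.\<close>

lemma stable_estimate:
  assumes p: "p \<in> S" and M: "1 < M"
  shows "\<forall>\<^sub>F q in at p within (S \<inter> {..<p}). q islimpt S \<longrightarrow>
    \<E> t (\<theta> q) + M * cost_to q \<le> \<E> t (\<theta> p) + M * cost_to p"
proof (cases "p islimpt (S \<inter> {..<p})")
  case False
  then have "at p within (S \<inter> {..<p}) = bot" by (simp add: trivial_limit_within)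
  then show ?thesis by simp
next
  case True
  then have p_lim: "p islimpt S" by (rule islimpt_subset) auto
  have stable: "(t, \<theta> q) \<in> stable_set T D \<E>" if "q \<in> S" "q islimpt S" for q
    using stable_at_limit[OF that] residual_le_iff[of D "\<theta> q" 0 \<E> t, OF D_refl] t
    by (simp add: stable_set_def quasi_stable_set_def)
  obtain \<eta> U where \<eta>: "0 < \<eta>" "open U" "\<theta> p \<in> U" and
    local: "\<And>s y. (s, y) \<in> stable_set T D \<E> \<Longrightarrow> s \<in> {t - \<eta><..t} \<Longrightarrow> y \<in> U \<Longrightarrow> d y (\<theta> p) \<le> ennreal \<eta> \<Longrightarrow>
      ereal (\<E> s y) \<le> ereal (\<E> s (\<theta> p)) + ereal M * enn2ereal (d y (\<theta> p))"
  proof -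
    from B have "\<forall>(t, x)\<in>stable_set T D \<E>. \<forall>M>1. \<exists>\<eta>>0. \<exists>U. open U \<and> x \<in> U \<and>
        (\<forall>(s, y)\<in>stable_set T D \<E>. s \<in> {t - \<eta><..t} \<and> y \<in> U \<and> d y x \<le> ennreal \<eta> \<longrightarrow>
          ereal (\<E> s y) \<le> ereal (\<E> s x) + ereal M * enn2ereal (d y x))"
      unfolding assumption_B_def Let_def by (elim conjE)
    from bspec[OF this stable[OF p p_lim], unfolded split, rule_format, OF M]
    show ?thesis by (elim exE conjE) (rule that, assumption+, blast)
  qed
  have "\<forall>\<^sub>F q in at p within S. \<theta> q \<in> U"
    using continuous p \<eta> unfolding continuous_on_def by (blast dest: topological_tendstoD)
  then have "\<forall>\<^sub>F q in at p within (S \<inter> {..<p}). \<theta> q \<in> U"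
    by (rule filter_leD[OF at_le, rotated]) auto
  moreover have "\<forall>\<^sub>F q in at p within (S \<inter> {..<p}). d (\<theta> q) (\<theta> p) \<le> ennreal \<eta>"
    using dist_left_limit p \<eta> by simp
  moreover have "\<forall>\<^sub>F q in at p within (S \<inter> {..<p}). q \<in> S \<and> q < p"
    by (simp add: eventually_at_filter)
  ultimately show ?thesis
  proof (eventually_elim, intro impI)
    fix q assume elim: "\<theta> q \<in> U" "d (\<theta> q) (\<theta> p) \<le> ennreal \<eta>" "q \<in> S \<and> q < p" "q islimpt S"
    then have q: "q \<in> S" "q < p" by auto
    obtain c where c: "d (\<theta> q) (\<theta> p) = ennreal c" "0 \<le> c"
      using elim(2) by (cases "d (\<theta> q) (\<theta> p)") (auto simp: top_unique)
    have "ennreal c \<le> ennreal (cost_to p - cost_to q)"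
      using cost_between_ge_dist[of q p] cost_to_diff(1)[of q p] q p c by auto
    then have "c \<le> cost_to p - cost_to q"
      using cost_to_diff(2)[of q p] q p by (simp add: ennreal_le_iff)
    then have "M * c \<le> M * (cost_to p - cost_to q)" using M by (intro mult_left_mono) auto
    moreover have "\<E> t (\<theta> q) \<le> \<E> t (\<theta> p) + M * c"
      using local[of t "\<theta> q"] stable[OF q(1) elim(4)] \<eta> elim c by simp
    ultimately show "\<E> t (\<theta> q) + M * cost_to q \<le> \<E> t (\<theta> p) + M * cost_to p"
      by (simp add: algebra_simps)
  qed
qed

lemma energy_estimate:
  assumes r: "r\<^sub>0 \<in> S" "r\<^sub>1 \<in> S" "r\<^sub>0 \<le> r\<^sub>1"
  shows "\<E> t (\<theta> r\<^sub>0) + cost_to r\<^sub>0 \<le> \<E> t (\<theta> r\<^sub>1) + cost_to r\<^sub>1"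
proof -
  have "\<E> t (\<theta> r\<^sub>0) + M * cost_to r\<^sub>0 \<le> \<E> t (\<theta> r\<^sub>1) + M * cost_to r\<^sub>1" if M: "1 < M" for M
  proof (rule le_on_compact[OF compact, of "\<lambda>r. \<E> t (\<theta> r) + M * cost_to r"])
    fix a b assume ab: "a \<in> S" "b \<in> S" "a < b" "S \<inter> {a<..<b} = {}"
    \<comment> \<open>Across a gap the weight \<open>1\<close> suffices; as \<open>cost_to\<close>
      is nondecreasing, it may be raised to \<open>M\<close>.\<close>
    have "cost_to b - cost_to a \<le> M * (cost_to b - cost_to a)"
      using M cost_to_diff(2)[of a b] ab by (simp add: mult_le_cancel_right1)
    with gap_estimate[OF ab] show "\<E> t (\<theta> a) + M * cost_to a \<le> \<E> t (\<theta> b) + M * cost_to b"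
      by (simp add: algebra_simps)
  next
    fix a c assume a: "a \<in> S"
      and fr: "\<exists>\<^sub>F r in at a within (S \<inter> {a<..}). \<E> t (\<theta> r) + M * cost_to r \<le> c"
    show "\<E> t (\<theta> a) + M * cost_to a \<le> c"
    proof (rule ccontr)
      \<comment> \<open>Near \<open>a\<close> on the right, lower semicontinuity of the energy and
        monotonicity of \<open>cost_to\<close> keep the sum above \<open>c\<close>.\<close>
      assume "\<not> ?thesis"
      then have "\<forall>\<^sub>F r in at a within S. c - M * cost_to a < \<E> t (\<theta> r)"
        using energy_lsc_along a unfolding lsc_on_def by auto
      then have "\<forall>\<^sub>F r in at a within (S \<inter> {a<..}). c - M * cost_to a < \<E> t (\<theta> r)"
        by (rule filter_leD[OF at_le, rotated]) auto
      moreover have "\<forall>\<^sub>F r in at a within (S \<inter> {a<..}). r \<in> S \<and> a < r"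
        by (simp add: eventually_at_filter)
      ultimately have "\<forall>\<^sub>F r in at a within (S \<inter> {a<..}). \<not> \<E> t (\<theta> r) + M * cost_to r \<le> c"
      proof eventually_elim
        case (elim r)
        then have "M * cost_to a \<le> M * cost_to r"
          using cost_to_diff(2)[of a r] a M by (intro mult_left_mono) auto
        with elim show ?case by linarith
      qed
      with fr show False by (simp add: frequently_def)
    qed
  next
    fix b \<epsilon> :: real assume b: "b \<in> S" and "0 < \<epsilon>"
    from energy_left_usc[OF this]
    have "\<forall>\<^sub>F q in at b within (S \<inter> {..<b}). \<E> t (\<theta> q) \<le> \<E> t (\<theta> b) + \<epsilon>" .
    moreover have "\<forall>\<^sub>F q in at b within (S \<inter> {..<b}). q \<in> S \<and> q < b"
      by (simp add: eventually_at_filter)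
    ultimately show "\<forall>\<^sub>F q in at b within (S \<inter> {..<b}).
        \<E> t (\<theta> q) + M * cost_to q \<le> \<E> t (\<theta> b) + M * cost_to b + \<epsilon>"
    proof eventually_elim
      case (elim q)
      then have "M * cost_to q \<le> M * cost_to b"
        using cost_to_diff(2)[of q b] b M by (intro mult_left_mono) auto
      with elim show ?case by linarith
    qed
  qed (use r stable_estimate[OF _ M] in auto)
  then have "\<forall>\<^sub>F M in at_right 1. \<E> t (\<theta> r\<^sub>0) + M * cost_to r\<^sub>0 \<le> \<E> t (\<theta> r\<^sub>1) + M * cost_to r\<^sub>1"
    by (simp add: eventually_at_filter)
  then have "\<E> t (\<theta> r\<^sub>0) + 1 * cost_to r\<^sub>0 \<le> \<E> t (\<theta> r\<^sub>1) + 1 * cost_to r\<^sub>1"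
    by (intro tendsto_le[of "at_right (1::real)" "\<lambda>M. \<E> t (\<theta> r\<^sub>1) + M * cost_to r\<^sub>1" _
          "\<lambda>M. \<E> t (\<theta> r\<^sub>0) + M * cost_to r\<^sub>0"] tendsto_intros) auto
  then show ?thesis by simp
qed

lemma energy_drop_le_Trc:
  "ereal (\<E> t (\<theta> (Inf S)) - \<E> t (\<theta> (Sup S))) \<le> enn2ereal (Trc d \<delta> \<E> t \<theta> S)"
  using energy_estimate[of "Inf S" "Sup S"] compact_Inf_mem[OF compact nonempty]
    compact_Sup_mem[OF compact nonempty] compact_le_Sup[OF compact] cost_to_nonneg cost_to_Inf
  by (simp add: Trc_eq_cost_to)

end

section \<open>Descending minimizing curves\<close>

definition descending ::
    "('a \<Rightarrow> 'a \<Rightarrow> ennreal) \<Rightarrow> (real \<Rightarrow> 'a \<Rightarrow> real) \<Rightarrow> real \<Rightarrow> (real \<Rightarrow> 'a) \<Rightarrow> real set \<Rightarrow> bool" where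
  "descending d \<E> t \<theta> S \<longleftrightarrow> (\<forall>r\<^sub>0\<in>S. \<forall>r\<^sub>1\<in>S. r\<^sub>0 \<le> r\<^sub>1 \<longrightarrow>
     enn2ereal (Var d \<theta> (S \<inter> {r\<^sub>0..r\<^sub>1})) \<le> ereal (\<E> t (\<theta> r\<^sub>0) - \<E> t (\<theta> r\<^sub>1)))"

definition minimizing ::
    "('a \<Rightarrow> 'a \<Rightarrow> ennreal) \<Rightarrow> (real \<Rightarrow> 'a \<Rightarrow> real) \<Rightarrow> real \<Rightarrow> (real \<Rightarrow> 'a) \<Rightarrow> real set \<Rightarrow> bool" where
  "minimizing D \<E> t \<theta> S \<longleftrightarrow> (\<forall>r\<in>S - {Inf S}. \<theta> r \<in> minimal_set D \<E> t (\<theta> (pred_pt S r)))"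

lemma enn2ereal_le_ereal_iff: "enn2ereal a \<le> ereal b \<longleftrightarrow> 0 \<le> b \<and> a \<le> ennreal b"
proof (cases "0 \<le> b")
  case True
  then show ?thesis by (simp only: less_eq_ennreal.rep_eq enn2ereal_ennreal simp_thms)
next
  case False
  then have "ereal b < 0" by simp
  also have "0 \<le> enn2ereal a" by (rule enn2ereal_nonneg)
  finally show ?thesis using False by (simp only: not_le[symmetric] simp_thms)
qed

lemma descendingD:
  assumes "descending d \<E> t \<theta> S" "r\<^sub>0 \<in> S" "r\<^sub>1 \<in> S" "r\<^sub>0 \<le> r\<^sub>1"
  shows "\<E> t (\<theta> r\<^sub>1) \<le> \<E> t (\<theta> r\<^sub>0)"
    and "Var d \<theta> (S \<inter> {r\<^sub>0..r\<^sub>1}) \<le> ennreal (\<E> t (\<theta> r\<^sub>0) - \<E> t (\<theta> r\<^sub>1))"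
  using assms by (auto simp: descending_def enn2ereal_le_ereal_iff)

text \<open>The distance from \<open>x\<^sub>o\<close> grows by at most the energy drop, by the
  triangle inequality. In the converse direction this supplies the sublevel bound of
  \<open>ve_curve\<close>.\<close>

lemma (in ve_space) descending_bounded:
  assumes "descending d \<E> t \<theta> S" "compact S" "s \<in> S"
  shows "\<F> t (\<theta> s) \<le> \<F> t (\<theta> (Inf S))"
proof -
  have Inf: "Inf S \<in> S" "Inf S \<le> s"
    using compact_Inf_mem[OF assms(2)] compact_Inf_le[OF assms(2,3)] assms(3) by auto
  note desc = descendingD[OF assms(1) Inf(1) assms(3) Inf(2)]
  have "d x\<^sub>o (\<theta> s) \<le> d x\<^sub>o (\<theta> (Inf S)) + d (\<theta> (Inf S)) (\<theta> s)" by (rule d_triangle)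
  also have "d (\<theta> (Inf S)) (\<theta> s) \<le> Var d \<theta> (S \<inter> {Inf S..s})"
    using Inf assms(3) d_refl by (intro Var_ge_dist) auto
  also note desc(2)
  finally have "d x\<^sub>o (\<theta> s) \<le> d x\<^sub>o (\<theta> (Inf S)) + ennreal (\<E> t (\<theta> (Inf S)) - \<E> t (\<theta> s))"
    by (simp add: add_left_mono)
  moreover obtain a b where "d x\<^sub>o (\<theta> s) = ennreal a" "0 \<le> a" "d x\<^sub>o (\<theta> (Inf S)) = ennreal b" "0 \<le> b"
    using d_finite[of "\<theta> s"] d_finite[of "\<theta> (Inf S)"]
    by (cases "d x\<^sub>o (\<theta> s)"; cases "d x\<^sub>o (\<theta> (Inf S))") auto
  ultimately show ?thesis
    using desc(1) by (auto simp: augmented_energy_def ennreal_le_iff simp flip: ennreal_plus)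
qed

text \<open>A nondecreasing function with equal values at both ends is constant, so no portion of
  the curve can cost more than its own energy drop.\<close>

lemma (in ve_finite_curve) optimal_imp_descending_minimizing:
  assumes "ereal (\<E> t (\<theta> (Inf S)) - \<E> t (\<theta> (Sup S))) = enn2ereal (Trc d \<delta> \<E> t \<theta> S)"
  shows "descending d \<E> t \<theta> S" "minimizing D \<E> t \<theta> S"
proof -
  have Inf: "Inf S \<in> S" and Sup: "Sup S \<in> S"
    using compact_Inf_mem compact_Sup_mem compact nonempty by auto
  have eq: "\<E> t (\<theta> (Inf S)) - \<E> t (\<theta> (Sup S)) = cost_to (Sup S)"
    using assms cost_to_nonneg by (simp add: Trc_eq_cost_to)
  have drop: "cost_to r\<^sub>1 - cost_to r\<^sub>0 \<le> \<E> t (\<theta> r\<^sub>0) - \<E> t (\<theta> r\<^sub>1)"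
    if "r\<^sub>0 \<in> S" "r\<^sub>1 \<in> S" for r\<^sub>0 r\<^sub>1
    using energy_estimate[OF Inf that(1)] energy_estimate[OF that(2) Sup] eq cost_to_Inf
      compact_Inf_le[OF compact that(1)] compact_le_Sup[OF compact that(2)] by simp
  have cost_le: "cost_between r\<^sub>0 r\<^sub>1 \<le> ennreal (\<E> t (\<theta> r\<^sub>0) - \<E> t (\<theta> r\<^sub>1))"
    and energy_le: "\<E> t (\<theta> r\<^sub>1) \<le> \<E> t (\<theta> r\<^sub>0)"
    if "r\<^sub>0 \<in> S" "r\<^sub>1 \<in> S" "r\<^sub>0 \<le> r\<^sub>1" for r\<^sub>0 r\<^sub>1
    using cost_to_diff[OF that] drop[OF that(1,2)] ennreal_leI[OF drop[OF that(1,2)]]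
    by (auto intro: order.trans)
  show "descending d \<E> t \<theta> S"
    unfolding descending_def enn2ereal_le_ereal_iff
    using order.trans[OF cost_between_ge_Var cost_le] energy_le by simp
  show "minimizing D \<E> t \<theta> S"
    unfolding minimizing_def minimal_set_iff[of D, OF D_refl]
  proof
    fix r assume r: "r \<in> S - {Inf S}"
    then have "r \<in> S" "r \<noteq> Inf S" by auto
    with compact show "\<E> t (\<theta> r) \<le> \<E> t (\<theta> (pred_pt S r)) \<and> D (\<theta> (pred_pt S r)) (\<theta> r) +
      residual D \<E> t (\<theta> (pred_pt S r)) \<le> ennreal (\<E> t (\<theta> (pred_pt S r)) - \<E> t (\<theta> r))"
    proof (cases rule: pred_ptE)
      \<comment> \<open>Here \<open>pred_pt S r = r\<close>, and minimality reduces to a vanishing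
        residual.\<close>
      case 1
      have "r islimpt S" using 1(1) by (rule islimpt_subset) auto
      with 1 stable_at_limit[OF \<open>r \<in> S\<close>] D_refl show ?thesis by simp
    next
      case 2
      with \<open>r \<in> S\<close> show ?thesis
        by (intro conjI energy_le order.trans[OF cost_between_gap cost_le]) auto
    qed
  qed
qed

context ve_curve
begin

text \<open>The energy along the curve has a right limit at \<open>a\<close>, so that the energy drop across the
  gaps, which bounds the residual at their left endpoints, tends to \<open>0\<close> at \<open>a\<close>.\<close>

lemma residual_at_right_limit:
  assumes desc: "descending d \<E> t \<theta> S" and min: "minimizing D \<E> t \<theta> S"
    and a: "a \<in> S" "a islimpt (S \<inter> {a<..})"
  shows "residual D \<E> t (\<theta> a) = 0"
proof (rule residual_at_limit[OF a(1)])
  fix Q :: real assume Q: "0 < Q"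
  define e where "e r = \<E> t (\<theta> r)" for r
  \<comment> \<open>As \<open>e\<close> is nonincreasing, \<open>L\<close> is its limit at
    \<open>a\<close> from the right.\<close>
  define L where "L = Sup (e ` (S \<inter> {a<..}))"
  have ne: "e ` (S \<inter> {a<..}) \<noteq> {}" using a(2) by (force simp: islimpt_EMPTY)
  have bdd: "bdd_above (e ` (S \<inter> {a<..}))"
    using descendingD(1)[OF desc a(1)] by (intro bdd_aboveI[of _ "e a"]) (auto simp: e_def)
  obtain x where x: "x \<in> S" "a < x" "L - Q < e x"
    using less_cSupE[OF _ ne, of "L - Q"] Q by (auto simp: L_def)
  show "\<exists>\<^sub>F q in at a within S. residual D \<E> t (\<theta> q) \<le> ennreal Q"
    unfolding frequently_at
  proof (intro allI impI)
    fix \<eta> :: real assume "0 < \<eta>"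
    then obtain r where r: "r \<in> S" "a < r" "r < x" "r < a + \<eta>"
      using a(2) x(2) unfolding islimpt_approachable_real
      by (elim allE[of _ "min \<eta> (x - a)"]) force
    have r_ne: "r \<noteq> Inf S" using compact_Inf_le[OF compact a(1)] r by auto
    have min_r: "residual D \<E> t (\<theta> (pred_pt S r)) \<le> ennreal (e (pred_pt S r) - e r)"
      using min r(1) r_ne unfolding minimizing_def minimal_set_iff[of D, OF D_refl] e_def
      by (auto intro: order.trans[rotated])
    from compact r(1) r_ne
    show "\<exists>q\<in>S. q \<noteq> a \<and> dist q a < \<eta> \<and> residual D \<E> t (\<theta> q) \<le> ennreal Q"
    proof (cases rule: pred_ptE)
      \<comment> \<open>A left accumulation point is its own predecessor, so \<open>min_r\<close>
        makes its residual vanish.\<close>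
      case 1
      then show ?thesis using r min_r by (intro bexI[of _ r]) (auto simp: dist_real_def)
    next
      case 2
      let ?p = "pred_pt S r"
      \<comment> \<open>A point of \<open>S\<close> strictly between \<open>a\<close> and
        \<open>r\<close> keeps the predecessor of \<open>r\<close> away from
        \<open>a\<close>.\<close>
      obtain r' where "r' \<in> S" "a < r'" "r' < r"
        using a(2) r(2) unfolding islimpt_approachable_real by (elim allE[of _ "r - a"]) force
      with 2 have p: "a < ?p" by force
      have "e ?p \<le> L" unfolding L_def using 2 p bdd by (intro cSup_upper) auto
      moreover have "e x \<le> e r" using descendingD(1)[OF desc r(1) x(1)] r by (simp add: e_def)
      ultimately have "e ?p - e r \<le> Q" using x(3) by simp
      then have "residual D \<E> t (\<theta> ?p) \<le> ennreal Q" using min_r ennreal_leI order.trans by blast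
      then show ?thesis using 2 p r by (intro bexI[of _ ?p]) (auto simp: dist_real_def)
    qed
  qed
qed

text \<open>Induction on the largest atom \<open>a\<close>. At a right accumulation point the atom
  vanishes. Otherwise the curve is cut at \<open>a\<close> and its successor \<open>b\<close>:
  minimality pays for the gap, descent for the piece after \<open>b\<close>, and the induction
  hypothesis with right end \<open>a\<close> for the rest.\<close>

lemma partial_sum_le_energy_drop:
  assumes desc: "descending d \<E> t \<theta> S" and min: "minimizing D \<E> t \<theta> S"
    and "finite F" "F \<subseteq> S \<inter> {r\<^sub>0..<r\<^sub>1}" "r\<^sub>0 \<in> S" "r\<^sub>1 \<in> S" "r\<^sub>0 \<le> r\<^sub>1"
  shows "Var d \<theta> (S \<inter> {r\<^sub>0..r\<^sub>1}) + (\<Sum>a\<in>F. atom_cost d \<delta> \<E> t \<theta> S a)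
    \<le> ennreal (\<E> t (\<theta> r\<^sub>0) - \<E> t (\<theta> r\<^sub>1))"
  using assms(3,4,6,7)
proof (induction F arbitrary: r\<^sub>1 rule: finite_linorder_max_induct)
  case empty
  then show ?case using descendingD(2)[OF desc] assms(5) by simp
next
  case (insert a F)
  let ?e = "\<lambda>r. \<E> t (\<theta> r)" and ?w = "atom_cost d \<delta> \<E> t \<theta> S"
    and ?V = "\<lambda>x y. Var d \<theta> (S \<inter> {x..y})"
  have a: "a \<in> S" "r\<^sub>0 \<le> a" "a < r\<^sub>1" using insert.prems by auto
  then have "a \<noteq> Sup S" using compact_le_Sup[OF compact insert.prems(2)] by auto
  have sum: "sum ?w (insert a F) = ?w a + sum ?w F"
    using insert.hyps by (subst sum.insert) auto
  from compact a(1) \<open>a \<noteq> Sup S\<close> show ?case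
  proof (cases rule: succ_ptE)
    case 1
    then have "?w a = 0"
      using residual_at_right_limit[OF desc min a(1)] \<delta>_refl by (simp add: atom_cost_def)
    then show ?thesis using insert.IH[of r\<^sub>1] insert.prems sum by simp
  next
    case 2
    define b where "b = succ_pt S a"
    have b: "b \<in> S" "a < b" "S \<inter> {a<..<b} = {}" using 2 by (auto simp: b_def)
    then have "b \<le> r\<^sub>1" using a insert.prems(2) by force
    have "b \<noteq> Inf S" using compact_Inf_le[OF compact a(1)] b by auto
    then have "?e b \<le> ?e a" and gap: "D (\<theta> a) (\<theta> b) + residual D \<E> t (\<theta> a) \<le> ennreal (?e a - ?e b)"
      using min b pred_pt_eq[OF compact a(1) b(2,3)]
      unfolding minimizing_def minimal_set_iff[of D, OF D_refl] by auto
    have drops: "?e a \<le> ?e r\<^sub>0" "?e r\<^sub>1 \<le> ?e b"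
      using descendingD(1)[OF desc] assms(5) a b insert.prems(2) \<open>b \<le> r\<^sub>1\<close> by auto
    have "F \<subseteq> S \<inter> {r\<^sub>0..<a}" using insert.hyps insert.prems by fastforce
    then have IH_a: "?V r\<^sub>0 a + sum ?w F \<le> ennreal (?e r\<^sub>0 - ?e a)"
      using insert.IH[of a] a by simp
    have "?V r\<^sub>0 r\<^sub>1 \<le> ?V r\<^sub>0 a + ?V a r\<^sub>1"
      using a by (intro Var_subadditive d_refl d_triangle) auto
    also have "?V a r\<^sub>1 \<le> ?V a b + ?V b r\<^sub>1"
      using b \<open>b \<le> r\<^sub>1\<close> by (intro Var_subadditive d_refl d_triangle) auto
    also have "?V a b \<le> d (\<theta> a) (\<theta> b)" using b by (intro Var_gap_le)
    finally have "?V r\<^sub>0 r\<^sub>1 + sum ?w (insert a F)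
        \<le> ?V r\<^sub>0 a + (d (\<theta> a) (\<theta> b) + ?V b r\<^sub>1) + sum ?w (insert a F)"
      by (simp add: add_mono)
    also have "\<dots> = (?V r\<^sub>0 a + sum ?w F) + (D (\<theta> a) (\<theta> b) + residual D \<E> t (\<theta> a)) + ?V b r\<^sub>1"
      unfolding sum by (simp add: atom_cost_def D_of_def b_def ac_simps)
    also have "\<dots> \<le> ennreal (?e r\<^sub>0 - ?e a) + ennreal (?e a - ?e b) + ennreal (?e b - ?e r\<^sub>1)"
      using IH_a insert.prems b \<open>b \<le> r\<^sub>1\<close>
      by (intro add_mono gap descendingD(2)[OF desc]) auto
    also have "\<dots> = ennreal (?e r\<^sub>0 - ?e r\<^sub>1)"
      using drops \<open>?e b \<le> ?e a\<close> by (simp flip: ennreal_plus)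
    finally show ?thesis .
  qed
qed

lemma Trc_le_energy_drop:
  assumes desc: "descending d \<E> t \<theta> S" and min: "minimizing D \<E> t \<theta> S"
  shows "Trc d \<delta> \<E> t \<theta> S \<le> ennreal (\<E> t (\<theta> (Inf S)) - \<E> t (\<theta> (Sup S)))"
proof -
  let ?w = "atom_cost d \<delta> \<E> t \<theta> S" and ?A = "S \<inter> {Inf S..<Sup S}"
  have mem: "Inf S \<in> S" "Sup S \<in> S" "Inf S \<le> Sup S"
    using compact_Inf_mem[OF compact nonempty] compact_Sup_mem[OF compact nonempty]
      compact_le_Sup[OF compact] by auto
  have "{F. finite F \<and> F \<subseteq> ?A} \<noteq> {}" by auto
  then have "Trc d \<delta> \<E> t \<theta> S
      = (SUP F\<in>{F. finite F \<and> F \<subseteq> ?A}. Var d \<theta> (S \<inter> {Inf S..Sup S}) + sum ?w F)"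
    using Trc_eq_partial_cost[of S \<delta> d \<E> t \<theta>] compact nonempty \<delta>_refl
    by (simp add: partial_cost_def nonneg_infsum_complete ennreal_SUP_add_right)
  also have "\<dots> \<le> ennreal (\<E> t (\<theta> (Inf S)) - \<E> t (\<theta> (Sup S)))"
    using partial_sum_le_energy_drop[OF desc min _ _ mem] by (intro SUP_least) auto
  finally show ?thesis .
qed

end

text \<open>A one-point curve at \<open>u t\<close> satisfies the variation and minimality
  conditions without joining \<open>um\<close> to \<open>up\<close>, which is why the endpoint
  conditions stand on the right-hand side.\<close>

theorem theorem3p16:
  fixes T F\<^sub>o t :: real
    and x\<^sub>o :: "'a::{t2_space,first_countable_topology}"
    and d \<delta> :: "'a \<Rightarrow> 'a \<Rightarrow> ennreal"
    and \<E> \<P> :: "real \<Rightarrow> 'a \<Rightarrow> real"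
    and u \<theta> :: "real \<Rightarrow> 'a"
    and E :: "real set"
  defines "um \<equiv> left_val 0 u t" and "up \<equiv> right_val T u t"
  assumes setting: "ve_setting T x\<^sub>o d \<delta> \<E> F\<^sub>o"
    and A: "assumption_A T x\<^sub>o d \<E> F\<^sub>o \<P>"
    and B: "assumption_B T x\<^sub>o d \<delta> \<E> F\<^sub>o"
    and C: "assumption_C T x\<^sub>o d \<delta> \<E> F\<^sub>o"
    and u_BV: "u \<in> BV d 0 T"
    and u_VE: "VE_solution T d \<delta> \<E> \<P> u"
    and t_jump: "t \<in> jump_set 0 T u"
    and bdd: "bounded_transitions d \<delta> \<E> (augmented_energy d x\<^sub>o F\<^sub>o \<E>) t um up"
    and E_compact: "compact E"
    and \<theta>_curve: "\<theta> \<in> C_curves d E"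
    and \<theta>_meets: "u t \<in> \<theta> ` E"
  shows
    "(optimal_transition d \<delta> \<E> t um up \<theta> E \<and>
      u t \<in> \<theta> ` E \<and>
      ereal (\<E> t um - \<E> t up) = enn2ereal (Trc d \<delta> \<E> t \<theta> E))
     \<longleftrightarrow>
     (\<theta> (Inf E) = um \<and> \<theta> (Sup E) = up \<and>
      (\<forall>r\<^sub>0\<in>E. \<forall>r\<^sub>1\<in>E. r\<^sub>0 \<le> r\<^sub>1 \<longrightarrow>
         enn2ereal (Var d \<theta> (E \<inter> {r\<^sub>0..r\<^sub>1})) \<le> ereal (\<E> t (\<theta> r\<^sub>0) - \<E> t (\<theta> r\<^sub>1))) \<and>
      (\<forall>r\<in>E - {Inf E}. \<theta> r \<in> minimal_set (D_of d \<delta>) \<E> t (\<theta> (pred_pt E r))))"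
proof -
  interpret ve_space T F\<^sub>o x\<^sub>o d \<delta> \<E> \<P>
    using setting A B C by unfold_locales
  have t: "t \<in> {0..T}" using t_jump by (simp add: jump_set_def)
  \<comment> \<open>\<open>bdd\<close> supplies, for each transition of finite cost, the sublevel in
    which the energy estimates work.\<close>
  have finite_curve: "\<exists>K. ve_finite_curve T F\<^sub>o x\<^sub>o d \<delta> \<E> \<P> t K \<theta>' S"
    if "(\<theta>', S) \<in> transitions d um up" "Trc d \<delta> \<E> t \<theta>' S < \<infinity>" for \<theta>' S
  proof -
    have "bdd_above ((\<lambda>s. \<F> t (\<theta>' s)) ` S)"
      using bspec[OF bdd[unfolded bounded_transitions_def] that(1)] that(2) by simp
    then obtain K where "\<And>s. s \<in> S \<Longrightarrow> \<F> t (\<theta>' s) \<le> K" by (auto simp: bdd_above_def)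
    then show ?thesis using that t
      by (intro exI[of _ K]) (unfold_locales, auto simp: transitions_def)
  qed
  \<comment> \<open>The bound is trivial for infinite cost, so it holds for every competitor in the
    infimum defining \<open>cost\<close>.\<close>
  have drop_le: "ereal (\<E> t um - \<E> t up) \<le> enn2ereal (Trc d \<delta> \<E> t \<theta>' S)"
    if "(\<theta>', S) \<in> transitions d um up" for \<theta>' S
  proof (cases "Trc d \<delta> \<E> t \<theta>' S < \<infinity>")
    case True
    with finite_curve[OF that] that show ?thesis
      using ve_finite_curve.energy_drop_le_Trc by (fastforce simp: transitions_def)
  qed (auto simp: less_top[symmetric])
  have "(optimal_transition d \<delta> \<E> t um up \<theta> E \<and>
      ereal (\<E> t um - \<E> t up) = enn2ereal (Trc d \<delta> \<E> t \<theta> E)) \<longleftrightarrow>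
     (\<theta> (Inf E) = um \<and> \<theta> (Sup E) = up \<and> descending d \<E> t \<theta> E \<and> minimizing D \<E> t \<theta> E)"
    (is "?opt \<longleftrightarrow> ?char")
  proof
    assume opt: ?opt
    then have tr: "(\<theta>, E) \<in> transitions d um up" by (simp add: optimal_transition_def)
    have "Trc d \<delta> \<E> t \<theta> E < \<infinity>" using opt by (auto simp: less_top[symmetric])
    from finite_curve[OF tr this] obtain K where "ve_finite_curve T F\<^sub>o x\<^sub>o d \<delta> \<E> \<P> t K \<theta> E" ..
    then interpret ve_finite_curve T F\<^sub>o x\<^sub>o d \<delta> \<E> \<P> t K \<theta> E .
    show ?char
      using optimal_imp_descending_minimizing opt tr by (simp add: transitions_def)
  next
    assume char: ?char
    then have tr: "(\<theta>, E) \<in> transitions d um up"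
      using E_compact \<theta>_curve \<theta>_meets by (auto simp: transitions_def)
    \<comment> \<open>The sublevel is that of the initial point, and \<open>\<theta>_meets\<close>
      makes \<open>E\<close> nonempty.\<close>
    interpret ve_curve T F\<^sub>o x\<^sub>o d \<delta> \<E> \<P> t "\<F> t (\<theta> (Inf E))" \<theta> E
      using E_compact \<theta>_curve \<theta>_meets t descending_bounded char by unfold_locales auto
    have le: "Trc d \<delta> \<E> t \<theta> E \<le> ennreal (\<E> t um - \<E> t up)"
      using Trc_le_energy_drop char by auto
    have ge: "ennreal (\<E> t um - \<E> t up) \<le> Trc d \<delta> \<E> t \<theta>' S"
      if "(\<theta>', S) \<in> transitions d um up" for \<theta>' S
      using drop_le[OF that] by (metis e2ennreal_enn2ereal e2ennreal_ereal e2ennreal_mono)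
    \<comment> \<open>Since \<open>ennreal\<close> truncates negative reals to \<open>0\<close>, the
      sign is needed to read \<open>le\<close> and \<open>ge\<close> as an equality of
      reals.\<close>
    have "0 \<le> \<E> t um - \<E> t up"
      using char descendingD(1)[of d \<E> t \<theta> E "Inf E" "Sup E"] nonempty compact_Inf_mem[OF compact]
        compact_Sup_mem[OF compact] compact_le_Sup[OF compact] by auto
    then have eq: "ereal (\<E> t um - \<E> t up) = enn2ereal (Trc d \<delta> \<E> t \<theta> E)"
      using le ge[OF tr] by (metis antisym enn2ereal_ennreal)
    have "cost d \<delta> \<E> t um up = Trc d \<delta> \<E> t \<theta> E"
      unfolding cost_def
    proof (rule antisym)
      show "(INF (\<theta>, E)\<in>transitions d um up. Trc d \<delta> \<E> t \<theta> E) \<le> Trc d \<delta> \<E> t \<theta> E"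
        using INF_lower[OF tr, of "\<lambda>(\<theta>, E). Trc d \<delta> \<E> t \<theta> E"] by simp
      show "Trc d \<delta> \<E> t \<theta> E \<le> (INF (\<theta>, E)\<in>transitions d um up. Trc d \<delta> \<E> t \<theta> E)"
        using ge le by (intro INF_greatest) (auto intro: order.trans)
    qed
    with tr eq show ?opt by (simp add: optimal_transition_def)
  qed
  then show ?thesis using \<theta>_meets unfolding descending_def minimizing_def by blast
qed

end
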